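(* Let $\mu = w\,dm + \mu_s$ be a probability measure on the unit circle $\mathbb{T}$, where $w\in L^1(\mathbb{T})$ and $\mu_s$ is singular with respect to $m$. Suppose that $w$ and $\log w$ belong to $L^1(\mathbb{T})$, that $\xi_0 \in \mathbb{T}$ is a Lebesgue point of both functions $w$ and $\log w$, and that $\lim_{\varepsilon \to 0}\mu_s(I_{\xi_0, \varepsilon})/m(I_{\xi_0, \varepsilon}) = 0$. Then $$\lim_{n \to+\infty}\frac{1}{n}\sum_{k=0}^{n-1}|\phi_k(\xi_0)|^2 = w(\xi_0)^{-1}.$$
   Context: $\mathbb{T}=\{z\in\mathbb{C}:|z|=1\}$; $m$ is Lebesgue measure on $\mathbb{T}$ normalized by $m(\mathbb{T})=1$, and $L^1(\mathbb{T})=L^1(m)$. $I_{\xi_0,\varepsilon}=\{\xi\in\mathbb{C}: |\xi-\xi_0|<\varepsilon\}$; measures on $\mathbb{T}$ are regarded as measures on $\mathbb{C}$, so $m(I_{\xi_0,\varepsilon})$ means $m(I_{\xi_0,\varepsilon}\cap\mathbb{T})$, etc. A point $\xi_0\in\mathbb{T}$ is a Lebesgue point of $g\in L^1(\mathbb{T})$ if there is a representative of $g$ (denoted by the same letter) with $\lim_{\varepsilon\to0}\frac{1}{m(I_{\xi_0,\varepsilon})}\int_{I_{\xi_0,\varepsilon}}|g-g(\xi_0)|\,dm=0$; $w(\xi_0)$ denotes the value at $\xi_0$ determined in this way. $\phi_n$, $n\ge0$, are the orthonormal polynomials in $L^2(\mu)$ obtained from $1,z,z^2,\dots$ by Gram–Schmidt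 orthogonalization. *)

theory Defs
  imports "HOL-Probability.Probability" "HOL-Computational_Algebra.Polynomial"
begin

text \<open>
  Measures on the unit circle are Borel measures on the complex plane that vanish
  off the circle, so that \<open>ball \<xi> \<epsilon>\<close> plays the role of the arc \<open>I\<^bsub>\<xi>,\<epsilon>\<^esub>\<close>.
\<close>

definition circle_measure :: "complex measure" where
  "circle_measure = distr (uniform_measure lborel {0..<2 * pi}) borel cis"

definition mutually_singular :: "'a measure \<Rightarrow> 'a measure \<Rightarrow> bool" where
  "mutually_singular M N \<longleftrightarrow>
     (\<exists>A\<in>sets M \<inter> sets N. emeasure M A = 0 \<and> emeasure N (space N - A) = 0)"

text \<open>
  An element of \<open>L\<^sup>1\<close> of the circle is given by any function \<open>g\<close> in its class. Different
  representatives \<open>h\<close> witnessing the Lebesgue point condition have the same value at \<open>\<xi>\<close>,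
  so the description operator in \<open>lebesgue_value\<close> is well defined at Lebesgue points.
\<close>

definition lebesgue_representative ::
    "(complex \<Rightarrow> real) \<Rightarrow> complex \<Rightarrow> (complex \<Rightarrow> real) \<Rightarrow> bool" where
  "lebesgue_representative g \<xi> h \<longleftrightarrow>
     integrable circle_measure h \<and>
     (AE z in circle_measure. h z = g z) \<and>
     ((\<lambda>\<epsilon>. 1 / measure circle_measure (ball \<xi> \<epsilon>) *
            (LINT z:ball \<xi> \<epsilon>|circle_measure. \<bar>h z - h \<xi>\<bar>)) \<longlongrightarrow> 0) (at_right 0)"

definition lebesgue_point :: "(complex \<Rightarrow> real) \<Rightarrow> complex \<Rightarrow> bool" where
  "lebesgue_point g \<xi> \<longleftrightarrow> (\<exists>h. lebesgue_representative g \<xi> h)"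

definition lebesgue_value :: "(complex \<Rightarrow> real) \<Rightarrow> complex \<Rightarrow> real" where
  "lebesgue_value g \<xi> = (THE v. \<exists>h. lebesgue_representative g \<xi> h \<and> h \<xi> = v)"

definition L2_inner :: "complex measure \<Rightarrow> complex poly \<Rightarrow> complex poly \<Rightarrow> complex" where
  "L2_inner \<mu> p q = (LINT z|\<mu>. poly p z * cnj (poly q z))"

definition L2_norm :: "complex measure \<Rightarrow> complex poly \<Rightarrow> real" where
  "L2_norm \<mu> p = sqrt (LINT z|\<mu>. (cmod (poly p z))\<^sup>2)"

text \<open>
  Gram--Schmidt applied to \<open>1, z, z\<^sup>2, \<dots>\<close>. If the residual has norm zero, which cannot
  happen when the support of \<open>\<mu>\<close> is infinite, the division convention yields the zero polynomial.
\<close>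

function orthonormal_poly :: "complex measure \<Rightarrow> nat \<Rightarrow> complex poly" where
  "orthonormal_poly \<mu> n =
     (let p = monom 1 n - (\<Sum>k<n. smult (L2_inner \<mu> (monom 1 n) (orthonormal_poly \<mu> k))
                                         (orthonormal_poly \<mu> k))
      in smult (complex_of_real (1 / L2_norm \<mu> p)) p)"
  by auto
termination
  by (relation "Wellfounded.measure snd") auto

text \<open>The recursive equation would make the simplifier loop.\<close>
declare orthonormal_poly.simps [simp del]

end

theory Submission
  imports Defs "HOL-Complex_Analysis.Complex_Analysis"
    "HOL-Computational_Algebra.Fundamental_Theorem_Algebra"
    "HOL-Real_Asymp.Real_Asymp"
begin

text \<open>
  The sum over \<open>k < n\<close> is the maximum of \<open>\<bar>p(\<xi>\<^sub>0)\<bar>\<^sup>2 / \<integral>\<bar>p\<bar>\<^sup>2 d\<mu>\<close> over polynomials of degree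
  below \<open>n\<close>. Testing with the Dirichlet kernel turns the denominator into a Fejer mean of \<open>\<mu>\<close> at the
  Lebesgue point \<open>\<xi>\<^sub>0\<close>, which gives the lower bound.

  For the upper bound, evaluation is moved to \<open>a = (1 - \<delta>/n) \<xi>\<^sub>0\<close>: once the zeros of \<open>p\<close>
  are reflected out of the disc, its modulus shrinks by no more than the factor \<open>(1 - \<delta>/(2n))\<^sup>n\<close>.
  If \<open>w = \<bar>D\<bar>\<^sup>2\<close> with \<open>D\<close> outer, then \<open>p(a) D(a)\<close> is the integral of \<open>p D\<close> against the Cauchy kernel at \<open>a\<close>, while \<open>p (cnj D) z\<^sup>-\<^sup>n\<close> integrates
  to zero against it. Subtracting a multiple of the second integral and applying the Cauchy-Schwarz
  inequality leaves the sharp constant \<open>n\<close> up to the Poisson average of \<open>\<bar>D/D(a) - 1\<bar>\<^sup>2\<close>. This average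
  is \<open>A/E - 1\<close>, where \<open>A\<close> is the Poisson average of \<open>w\<close> and \<open>E\<close> is the exponential of that of \<open>ln w\<close>,
  so it vanishes in the limit at a common Lebesgue point of \<open>w\<close> and \<open>ln w\<close>.
  Boundary values of outer functions are avoided by replacing \<open>ln w\<close> with its Fejer means: these are
  real parts of polynomials, and by Jensen's inequality their exponentials lie below the Fejer means of \<open>w\<close>.
\<close>

section \<open>Integration on the circle\<close>

text \<open>The distance \<delta>/n is forced from two sides. Farther inside, the loss of modulus
  along the radius is no longer bounded independently of \<open>n\<close>. Closer to the circle, 1 -
  |a|^2 is too small: it enters the error as sqrt ((A/E - 1) / (1 - |a|^2)), which at distance
  \<delta>/n is at most sqrt n times sqrt ((A/E - 1) / \<delta>) and so is small against sqrt n for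
  fixed \<delta>. Hence \<delta> is fixed by the inequality to be proved, and only then does
  \<open>n\<close> grow. The zeros must be reflected because a polynomial can be large at
  \<open>\<xi>\<^sub>0\<close> and vanish at \<open>a\<close>; integrals over the circle do not
  notice the change. All local statements reduce to one dyadic estimate for kernels of height O(n)
  and decay O(1/(n |z - x|^2)) against a measure with little mass on small arcs. It serves the
  singular part and, with the measure |h - h x| dm, the Lebesgue points of \<open>w\<close> and
  \<open>ln w\<close>.\<close>

lemma sets_circle_measure [measurable_cong, simp]: "sets circle_measure = sets borel"
  by (simp add: circle_measure_def)

lemma space_circle_measure [simp]: "space circle_measure = UNIV"
  by (simp add: circle_measure_def)

lemma borel_measurable_cis [measurable]: "cis \<in> borel_measurable borel"
  by (intro borel_measurable_continuous_onI continuous_intros)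

lemma emeasure_lborel_period: "emeasure lborel {0..<2 * pi} = ennreal (2 * pi)"
  by (simp add: emeasure_lborel_Ico)

lemma prob_space_circle_measure: "prob_space circle_measure"
proof -
  interpret U: prob_space "uniform_measure lborel {0..<2 * pi}"
    by (rule prob_space_uniform_measure) (auto simp: emeasure_lborel_period)
  show ?thesis
    unfolding circle_measure_def by (rule U.prob_space_distr) simp
qed

interpretation circle: prob_space circle_measure
  by (rule prob_space_circle_measure)

lemma AE_circle_norm: "AE z in circle_measure. norm z = 1"
  unfolding circle_measure_def by (subst AE_distr_iff) auto

text \<open>Contour integrals are parametrized over the closed interval. The extra endpoint
  \<open>2 * pi\<close> is a null set, hence the \<open>AE\<close> comparison of the two
  integrands.\<close>

lemma integral_circle_eq_interval:
  fixes f :: "complex \<Rightarrow> complex"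
  assumes [measurable]: "f \<in> borel_measurable borel"
  shows "(LINT z|circle_measure. f z)
         = (LINT t:{0..2 * pi}|lborel. f (cis t)) / complex_of_real (2 * pi)"
proof -
  have U: "uniform_measure lborel {0..<2 * pi}
         = density lborel (\<lambda>t. ennreal (indicator {0..<2 * pi} t / (2 * pi)))"
    unfolding uniform_measure_def emeasure_lborel_period
    by (intro density_cong)
      (auto simp: divide_ennreal[of 1 "2 * pi", simplified] indicator_def)
  have "(LINT z|circle_measure. f z)
        = (LINT t|lborel. (indicator {0..<2 * pi} t / (2 * pi)) *\<^sub>R f (cis t))"
    unfolding circle_measure_def U
    by (subst integral_distr) (auto intro!: integral_density)
  also have "\<dots> = (LINT t|lborel. (indicator {0..2 * pi} t *\<^sub>R f (cis t)) / complex_of_real (2 * pi))"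
  proof (rule integral_cong_AE)
    show "AE t in lborel. (indicator {0..<2 * pi} t / (2 * pi)) *\<^sub>R f (cis t)
       = (indicator {0..2 * pi} t *\<^sub>R f (cis t)) / complex_of_real (2 * pi)"
      using AE_lborel_singleton[of "2 * pi"]
      by eventually_elim (auto simp: indicator_def scaleR_conv_of_real)
  qed auto
  finally show ?thesis
    by (simp add: set_lebesgue_integral_def)
qed

text \<open>Along the circle dz = i z dt, which turns the Cauchy kernel 1/(z - a) into z/(z - a)
  against normalized arc length; for \<open>a = 0\<close> this is the mean value property. The
  separate \<open>g\<close> admits any measurable integrand that has this form on the circle
  alone.\<close>

lemma Cauchy_circle_measure:
  fixes f :: "complex \<Rightarrow> complex"
  assumes cont: "continuous_on (cball 0 1) f" and hol: "f holomorphic_on ball 0 1"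
    and a: "norm a < 1" and g: "g \<in> borel_measurable borel"
    and eq: "\<And>z. norm z = 1 \<Longrightarrow> g z = f z * z / (z - a)"
  shows "(LINT z|circle_measure. g z) = f a"
proof -
  have cl: "circlepath 0 1 = part_circlepath 0 1 0 (2 * pi)"
    by (simp add: circlepath_def)
  have "((\<lambda>u. f u / (u - a)) has_contour_integral (2 * of_real pi * \<i> * f a)) (circlepath 0 1)"
    by (rule Cauchy_integral_circlepath) (use cont hol a in auto)
  then have "((\<lambda>t. f (cis t) / (cis t - a) * \<i> * cis t) has_integral (2 * of_real pi * \<i> * f a))
      {0..2 * pi}"
    unfolding cl by (subst (asm) has_contour_integral_part_circlepath_iff) auto
  then have "((\<lambda>t. (- \<i> / (2 * pi)) * (f (cis t) / (cis t - a) * \<i> * cis t)) has_integral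
      (- \<i> / (2 * pi)) * (2 * of_real pi * \<i> * f a)) {0..2 * pi}"
    by (rule has_integral_mult_right)
  then have I: "((\<lambda>t. g (cis t) / (2 * pi)) has_integral f a) {0..2 * pi}"
    by (rule back_subst[of "\<lambda>x. x"]) (auto intro!: arg_cong2[where f = "\<lambda>f i. (f has_integral i) {0..2 * pi}"]
        simp: eq field_simps)
  have nz: "a \<noteq> cis t" for t
    using a by auto
  have "continuous_on {0..2 * pi} (\<lambda>t. f (cis t) * cis t / (cis t - a) / (2 * pi))"
    by (intro continuous_intros continuous_on_compose2[OF cont]) (use nz in auto)
  then have "continuous_on {0..2 * pi} (\<lambda>t. g (cis t) / (2 * pi))"
    by (simp add: eq)
  then have "set_integrable lborel {0..2 * pi} (\<lambda>t. g (cis t) / (2 * pi))"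
    by (rule borel_integrable_atLeastAtMost')
  then have "(LINT t:{0..2 * pi}|lborel. g (cis t) / (2 * pi)) = f a"
    using set_borel_integral_eq_integral(2) I by (metis integral_unique)
  then show ?thesis
    by (subst integral_circle_eq_interval[OF g]) (simp add: set_lebesgue_integral_def)
qed

text \<open>On the circle \<open>cnj z\<close> is the inverse of \<open>z\<close>, so the
  off-diagonal terms come in conjugate pairs and combine into twice the real part of a polynomial in
  \<open>z\<close> without constant term. The factor \<open>b\<close> covers both a rotation and an
  evaluation point inside the disc.\<close>

lemma geometric_sum_norm_square:
  fixes b z :: complex
  assumes "norm z = 1"
  shows "(norm (\<Sum>j<n. (b * z) ^ j))\<^sup>2
       = (\<Sum>j<n. norm b ^ (2 * j)) + 2 * Re (\<Sum>j<n. \<Sum>k<j. b ^ j * cnj b ^ k * z ^ (j - k))"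
proof (induction n)
  case (Suc n)
  have zz: "z * cnj z = 1"
    using assms by (simp add: complex_norm_square[symmetric])
  have zpow: "z ^ n * cnj z ^ k = z ^ (n - k)" if "k < n" for k
  proof -
    have "z ^ n * cnj z ^ k = z ^ (n - k) * (z * cnj z) ^ k"
      using that by (simp add: power_mult_distrib mult.assoc[symmetric] power_add[symmetric])
    then show ?thesis
      using zz by simp
  qed
  have sq: "(norm (x + y))\<^sup>2 = (norm x)\<^sup>2 + (norm y)\<^sup>2 + 2 * Re (y * cnj x)" for x y :: complex
    by (simp only: cmod_power2 complex_mult_cnj) (simp add: power2_eq_square algebra_simps)
  have "(b * z) ^ n * cnj (\<Sum>j<n. (b * z) ^ j) = (\<Sum>k<n. b ^ n * cnj b ^ k * z ^ (n - k))"
    unfolding cnj_sum sum_distrib_left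
    by (intro sum.cong) (auto simp: power_mult_distrib zpow[symmetric])
  moreover have "(norm ((b * z) ^ n))\<^sup>2 = norm b ^ (2 * n)"
    using assms by (simp add: norm_power norm_mult power_mult_distrib power_mult[symmetric] mult.commute)
  ultimately show ?case
    by (simp add: sq Suc.IH)
qed simp

section \<open>Integrability on the circle and the mass of small arcs\<close>

lemma measure_circle_measure_UNIV [simp]: "measure circle_measure UNIV = 1"
  using circle.prob_space by simp

lemma bounded_on_circle:
  fixes f :: "complex \<Rightarrow> 'b::real_normed_vector"
  assumes "continuous_on (sphere 0 1) f"
  obtains B where "0 \<le> B" "\<And>z. norm z = 1 \<Longrightarrow> norm (f z) \<le> B"
proof -
  have "bounded (f ` sphere 0 1)"
    using assms by (intro compact_imp_bounded compact_continuous_image) auto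
  then obtain B where B: "\<And>x. x \<in> f ` sphere 0 1 \<Longrightarrow> norm x \<le> B"
    unfolding bounded_iff by auto
  show ?thesis
  proof (rule that)
    show "norm (f z) \<le> max B 0" if "norm z = 1" for z
      using B[of "f z"] that by force
  qed auto
qed

text \<open>Continuity is asked on the circle and measurability everywhere, because kernels such as
  1/(z - a) are discontinuous off the circle.\<close>

lemma integrable_on_circle:
  fixes f :: "complex \<Rightarrow> 'b::{banach, second_countable_topology}"
  assumes M: "finite_measure M" "sets M = sets borel" "AE z in M. norm z = 1"
    and f: "f \<in> borel_measurable borel" "continuous_on (sphere 0 1) f"
  shows "integrable M f"
proof -
  interpret finite_measure M by fact
  obtain B where B: "\<And>z. norm z = 1 \<Longrightarrow> norm (f z) \<le> B"
    using bounded_on_circle[OF f(2)] by auto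
  show ?thesis
  proof (rule integrable_const_bound)
    show "AE z in M. norm (f z) \<le> B"
      using M(3) by eventually_elim (rule B)
    show "f \<in> borel_measurable M"
      using f(1) M(2) by (simp cong: measurable_cong_sets)
  qed
qed

lemmas integrable_circle_measure =
  integrable_on_circle[OF circle.finite_measure_axioms sets_circle_measure AE_circle_norm]

lemma integrable_mult_circle_measure:
  fixes f g :: "complex \<Rightarrow> 'b::{real_normed_field, banach, second_countable_topology}"
  assumes f: "f \<in> borel_measurable borel" "continuous_on (sphere 0 1) f"
    and g: "integrable circle_measure g"
  shows "integrable circle_measure (\<lambda>z. f z * g z)"
proof -
  obtain B where B: "0 \<le> B" "\<And>z. norm z = 1 \<Longrightarrow> norm (f z) \<le> B"
    using bounded_on_circle[OF f(2)] by auto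
  have [measurable]: "f \<in> borel_measurable circle_measure" "g \<in> borel_measurable circle_measure"
    using f(1) g by auto
  show ?thesis
  proof (rule Bochner_Integration.integrable_bound)
    show "integrable circle_measure (\<lambda>z. of_real B * g z)"
      using g by simp
    show "AE z in circle_measure. norm (f z * g z) \<le> norm (of_real B * g z)"
      using AE_circle_norm by eventually_elim (use B in \<open>auto simp: norm_mult intro!: mult_right_mono\<close>)
  qed auto
qed

text \<open>The integral of (f - s g)^2 is a nonnegative quadratic in \<open>s\<close>, evaluated at
  its minimizer B/C.\<close>

lemma integral_Cauchy_Schwarz:
  fixes f g :: "'a \<Rightarrow> real"
  assumes "integrable M (\<lambda>x. (f x)\<^sup>2)" "integrable M (\<lambda>x. (g x)\<^sup>2)" "integrable M (\<lambda>x. f x * g x)"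
  shows "(LINT x|M. f x * g x) \<le> sqrt (LINT x|M. (f x)\<^sup>2) * sqrt (LINT x|M. (g x)\<^sup>2)"
proof -
  define A where "A = (LINT x|M. (f x)\<^sup>2)"
  define B where "B = (LINT x|M. f x * g x)"
  define C where "C = (LINT x|M. (g x)\<^sup>2)"
  have nonneg: "0 \<le> A" "0 \<le> C"
    by (auto simp: A_def C_def)
  have quad: "0 \<le> C * s\<^sup>2 + (- 2 * B) * s + A" for s
  proof -
    have "0 \<le> (LINT x|M. (f x - s * g x)\<^sup>2)"
      by simp
    also have "\<dots> = (LINT x|M. (f x)\<^sup>2 - 2 * s * (f x * g x) + s\<^sup>2 * (g x)\<^sup>2)"
      by (intro Bochner_Integration.integral_cong) (auto simp: power2_eq_square algebra_simps)
    also have "\<dots> = A - 2 * s * B + s\<^sup>2 * C"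
      using assms by (simp add: A_def B_def C_def)
    finally show ?thesis
      by (simp add: algebra_simps)
  qed
  have "B\<^sup>2 \<le> A * C"
  proof (cases "C = 0")
    case True
    have "B = 0"
    proof (rule ccontr)
      assume "B \<noteq> 0"
      \<comment> \<open>With \<open>C = 0\<close> the quadratic degenerates to A - 2 B s, which
        equals -1 at this \<open>s\<close>.\<close>
      with quad[of "(A + 1) / (2 * B)"] True show False
        by simp
    qed
    then show ?thesis
      using nonneg by simp
  next
    case False
    with quad[of "B / C"] nonneg show ?thesis
      by (simp add: field_simps power2_eq_square)
  qed
  then have "\<bar>B\<bar> \<le> sqrt (A * C)"
    by (rule real_le_rsqrt[of "\<bar>B\<bar>", simplified])
  then show ?thesis
    unfolding A_def B_def C_def by (simp add: real_sqrt_mult)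
qed

text \<open>The off-diagonal part is the real part of a polynomial that vanishes at 0, so its mean
  is zero and only the diagonal survives.\<close>

lemma integral_geometric_sum_norm_square:
  "(LINT z|circle_measure. (norm (\<Sum>j<n. (b * z) ^ j))\<^sup>2) = (\<Sum>j<n. norm b ^ (2 * j))"
proof -
  define F where "F z = (\<Sum>j<n. \<Sum>k<j. b ^ j * cnj b ^ k * z ^ (j - k))" for z
  have contF: "continuous_on S F" for S
    unfolding F_def by (intro continuous_intros)
  have measF [measurable]: "F \<in> borel_measurable borel"
    using contF by (rule borel_measurable_continuous_onI)
  have "(LINT z|circle_measure. F z) = F 0"
  proof (rule Cauchy_circle_measure[where f = F and a = 0])
    show "F holomorphic_on ball 0 1"
      unfolding F_def by (intro holomorphic_intros)
  qed (auto simp: contF)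
  also have "F 0 = 0"
    unfolding F_def by (intro sum.neutral) (auto intro!: sum.neutral)
  finally have F0: "(LINT z|circle_measure. F z) = 0" .
  have intF: "integrable circle_measure F"
    by (rule integrable_circle_measure) (auto simp: contF)
  have "(LINT z|circle_measure. (norm (\<Sum>j<n. (b * z) ^ j))\<^sup>2)
      = (LINT z|circle_measure. (\<Sum>j<n. norm b ^ (2 * j)) + 2 * Re (F z))"
  proof (rule integral_cong_AE)
    show "AE z in circle_measure. (norm (\<Sum>j<n. (b * z) ^ j))\<^sup>2
        = (\<Sum>j<n. norm b ^ (2 * j)) + 2 * Re (F z)"
      using AE_circle_norm
      by eventually_elim (simp only: geometric_sum_norm_square F_def)
  qed auto
  also have "\<dots> = (\<Sum>j<n. norm b ^ (2 * j)) + 2 * Re (LINT z|circle_measure. F z)"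
    using intF by simp
  finally show ?thesis
    by (simp add: F0)
qed

text \<open>Markov's inequality: the squared geometric sum has mean \<open>n\<close>, but is at
  least n^2/4 on the ball, where the powers of \<open>cnj x * z\<close> stay close to 1. This yields
  the order of arc length without trigonometry.\<close>

lemma measure_circle_ball_le_aux:
  assumes x: "norm x = 1" and n: "n > 0"
  shows "measure circle_measure (ball x (1 / real n)) \<le> 4 / real n"
proof -
  define S where "S z = (norm (\<Sum>j<n. (cnj x * z) ^ j))\<^sup>2" for z
  have contS: "continuous_on A S" for A
    unfolding S_def by (intro continuous_intros)
  have [measurable]: "S \<in> borel_measurable borel"
    using contS by (rule borel_measurable_continuous_onI)
  have lower: "(real n)\<^sup>2 / 4 \<le> S z" if z: "norm z = 1" "z \<in> ball x (1 / real n)" for z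
  proof -
    define u where "u = cnj x * z"
    have xx: "cnj x * x = 1"
      using x by (metis complex_norm_square mult.commute of_real_1 power_one)
    have u1: "norm u = 1"
      using x z by (simp add: u_def norm_mult)
    have "u - 1 = cnj x * (z - x)"
      using xx by (simp add: u_def algebra_simps)
    then have "norm (u - 1) = norm (z - x)"
      using x by (simp add: norm_mult)
    also have "\<dots> \<le> 1 / real n"
      using z by (simp add: dist_norm norm_minus_commute)
    finally have un: "norm (u - 1) \<le> 1 / real n" .
    have pow: "norm (u ^ j - 1) \<le> real j * (1 / real n)" for j
    proof -
      have "norm (u ^ j - 1 ^ j) \<le> real j * norm (u - 1)"
        by (rule norm_power_diff) (use u1 in auto)
      also have "\<dots> \<le> real j * (1 / real n)"
        using un by (intro mult_left_mono) auto
      finally show ?thesis by simp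
    qed
    \<comment> \<open>The deviations of the powers from 1, at most j/n, add up to at most (n - 1)/2,
      so half of the value \<open>n\<close> of the sum at 1 remains.\<close>
    have "norm ((\<Sum>j<n. u ^ j) - of_nat n) = norm (\<Sum>j<n. u ^ j - 1)"
      by (simp add: sum_subtractf)
    also have "\<dots> \<le> (\<Sum>j<n. real j * (1 / real n))"
      by (intro sum_norm_le pow)
    also have "\<dots> = (\<Sum>j<n. real j) / real n"
      by (simp add: sum_divide_distrib)
    also have "(\<Sum>j<n. real j) = real n * (real n - 1) / 2"
      by (induction n) (auto simp: field_simps)
    also have "real n * (real n - 1) / 2 / real n \<le> real n / 2"
      using n by (simp add: field_simps)
    finally have "norm ((\<Sum>j<n. u ^ j) - of_nat n) \<le> real n / 2" .
    moreover have "real n \<le> norm (\<Sum>j<n. u ^ j) + norm ((\<Sum>j<n. u ^ j) - of_nat n)"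
      using norm_triangle_ineq4[of "\<Sum>j<n. u ^ j" "(\<Sum>j<n. u ^ j) - of_nat n"] by simp
    ultimately have "real n / 2 \<le> norm (\<Sum>j<n. u ^ j)"
      by linarith
    then have "(real n / 2)\<^sup>2 \<le> (norm (\<Sum>j<n. u ^ j))\<^sup>2"
      by (intro power_mono) auto
    then show ?thesis
      by (simp add: S_def u_def power_divide)
  qed
  have "(real n)\<^sup>2 / 4 * measure circle_measure (ball x (1 / real n))
      = (LINT z|circle_measure. (real n)\<^sup>2 / 4 * indicator (ball x (1 / real n)) z)"
    by simp
  also have "\<dots> \<le> (LINT z|circle_measure. S z)"
  proof (rule integral_mono_AE)
    show "AE z in circle_measure. (real n)\<^sup>2 / 4 * indicator (ball x (1 / real n)) z \<le> S z"
      using AE_circle_norm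
      by eventually_elim (use lower in \<open>auto simp: indicator_def S_def\<close>)
  qed (auto intro!: integrable_circle_measure contS integrable_real_indicator
      simp: circle.emeasure_eq_measure)
  also have "\<dots> = real n"
    unfolding S_def by (subst integral_geometric_sum_norm_square) (use x in simp)
  finally show ?thesis
    using n by (simp add: field_simps power2_eq_square)
qed

text \<open>For \<open>e < 1\<close> the radius is enlarged to 1/n with n = floor (1/e); as 1/e
  \<le> 2 n, rounding doubles the constant 4. For larger \<open>e\<close> the total mass 1
  suffices.\<close>

lemma measure_circle_ball_le:
  assumes x: "norm x = 1" and e: "0 < e"
  shows "measure circle_measure (ball x e) \<le> 8 * e"
proof (cases "e \<ge> 1")
  case True
  then show ?thesis
    using circle.prob_le_1[of "ball x e"] by linarith
next
  case False
  define n where "n = nat \<lfloor>1 / e\<rfloor>"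
  have e1: "1 / e \<ge> 1"
    using e False by simp
  have fl: "real n = of_int \<lfloor>1 / e\<rfloor>"
    unfolding n_def using e1 by (intro of_nat_nat) linarith
  have n1: "real n \<ge> 1"
    unfolding fl using e1 by simp
  have n2: "real n \<le> 1 / e"
    unfolding fl by (rule of_int_floor_le)
  have n3: "1 / e \<le> 2 * real n"
    using n1 real_of_int_floor_add_one_gt[of "1 / e"] unfolding fl by linarith
  have n: "n > 0"
    using n1 by simp
  have "e \<le> 1 / real n"
    using n2 n e by (simp add: field_simps)
  then have "measure circle_measure (ball x e) \<le> measure circle_measure (ball x (1 / real n))"
    by (intro circle.finite_measure_mono) auto
  also have "\<dots> \<le> 4 / real n"
    by (rule measure_circle_ball_le_aux[OF x n])
  also have "\<dots> \<le> 8 * e"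
    using n3 n e by (simp add: field_simps)
  finally show ?thesis .
qed

lemma measure_circle_ball_pos:
  assumes x: "norm x = 1" and e: "0 < e"
  shows "0 < measure circle_measure (ball x e)"
proof -
  obtain t where t: "0 \<le> t" "t < 2 * pi" "x = cis t"
    using x by (metis Arg2pi_ge_0 Arg2pi_lt_2pi Arg2pi_eq complex_norm_eq_1_exp cis_conv_exp mult_1 of_real_1)
  have "continuous_on UNIV cis"
    by (intro continuous_intros)
  then have "isCont cis t"
    by (simp add: continuous_on_eq_continuous_at)
  then obtain d where d: "d > 0" "\<And>s. dist s t < d \<Longrightarrow> dist (cis s) (cis t) < e"
    using e unfolding continuous_at_eps_delta by meson
  \<comment> \<open>Only an interval to the right of \<open>t\<close> is used, cut off at
    \<open>2 * pi\<close>, so that it stays inside the period even for \<open>t = 0\<close>.\<close>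
  define u where "u = min (t + d) (2 * pi)"
  have tu: "t < u"
    using t d by (auto simp: u_def)
  have sub: "{t<..<u} \<subseteq> {0..<2 * pi} \<inter> (cis -` ball x e)"
    using t d by (auto simp: u_def dist_commute dist_real_def)
  have "0 < emeasure lborel {t<..<u}"
    using tu by simp
  also have "\<dots> \<le> emeasure lborel ({0..<2 * pi} \<inter> (cis -` ball x e))"
    by (rule emeasure_mono[OF sub]) (measurable, simp)
  finally have "0 < emeasure (uniform_measure lborel {0..<2 * pi}) (cis -` ball x e)"
    using measurable_sets[OF borel_measurable_cis, of "ball x e"]
    by (subst emeasure_uniform_measure)
      (auto simp: emeasure_lborel_period ennreal_zero_less_divide)
  then have "0 < emeasure circle_measure (ball x e)"
    unfolding circle_measure_def by (subst emeasure_distr) auto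
  then show ?thesis
    by (simp add: circle.emeasure_eq_measure)
qed

section \<open>Peak kernels and Lebesgue points\<close>

lemma two_power_square: "(2 ^ n)\<^sup>2 = (4 :: real) ^ n"
  by (simp add: power2_eq_square power_mult_distrib[symmetric])

text \<open>Dominates a kernel value \<open>u\<close> at rescaled distance \<open>s\<close> by a
  staircase over dyadic balls. In the induction the old remainder 4^-J becomes the new summand if s
  < 2^(J+1); otherwise u \<le> s^-2 is already below the new remainder.\<close>

lemma dyadic_bound:
  fixes u s :: real
  assumes "u \<le> 1" "u * s\<^sup>2 \<le> 1"
  shows "u \<le> (\<Sum>j<J. (1 / 4) ^ j * of_bool (s < 2 ^ Suc j)) + (1 / 4) ^ J"
proof (induction J)
  case (Suc J)
  show ?case
  proof (cases "s < 2 ^ Suc J")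
    case True
    with Suc.IH show ?thesis
      by (simp del: power_Suc) (auto intro: order_trans)
  next
    case False
    then have "(2 ^ Suc J)\<^sup>2 \<le> s\<^sup>2"
      by (intro power_mono) auto
    then have s: "4 ^ Suc J \<le> s\<^sup>2"
      by (simp only: two_power_square)
    have "u \<le> (1 / 4) ^ Suc J"
    proof (cases "u \<le> 0")
      case True
      then show ?thesis
        by (rule order_trans) simp
    next
      case False
      then have "u * 4 ^ Suc J \<le> u * s\<^sup>2"
        using s by (intro mult_left_mono) auto
      with assms(2) show ?thesis
        by (simp add: field_simps power_divide)
    qed
    moreover have "0 \<le> (\<Sum>j<Suc J. (1 / 4) ^ j * of_bool (s < 2 ^ Suc j) :: real)"
      by (intro sum_nonneg) auto
    ultimately show ?thesis
      by linarith
  qed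
qed (use assms in simp)

text \<open>Dyadic balls of radius up to \<open>e0\<close> have mass at most \<eta> times their
  radius, so with weights 4^-j they form a geometric series whose sum, after scaling, is O(\<eta>)
  uniformly in \<open>N\<close>. The remainder of the staircase is charged with the total
  mass.\<close>

lemma kernel_integral_le:
  fixes k :: "complex \<Rightarrow> real"
  assumes fin: "finite_measure \<nu>" and sets [measurable_cong]: "sets \<nu> = sets borel"
    and k [measurable]: "k \<in> borel_measurable borel"
    and C: "0 \<le> C" and N: "0 < N"
    and bound: "AE z in \<nu>. 0 \<le> k z \<and> k z \<le> C * N \<and> k z * N * (norm (z - x))\<^sup>2 \<le> C"
    and e0: "0 < e0" "1 \<le> N * e0" and \<eta>: "0 \<le> \<eta>"
    and small: "\<And>e. 0 < e \<Longrightarrow> e \<le> e0 \<Longrightarrow> measure \<nu> (ball x e) \<le> \<eta> * e"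
  shows "(LINT z|\<nu>. k z) \<le> 4 * C * \<eta> + 4 * C * measure \<nu> UNIV / (N * e0\<^sup>2)"
proof -
  interpret finite_measure \<nu> by fact
  have sp [simp]: "space \<nu> = UNIV"
    using sets_eq_imp_space_eq[OF sets] by simp
  obtain J0 :: nat where J0: "N * e0 < 2 ^ J0"
    using real_arch_pow[of 2 "N * e0"] by auto
  \<comment> \<open>The aim is \<open>J\<close> with 2^J \<le> N e0 < 2^(J+1): the balls below then
    have radius at most \<open>e0\<close>, while 4^-J \<le> 4/(N e0)^2.\<close>
  define J1 where "J1 = (LEAST j. N * e0 < 2 ^ j)"
  have J1: "N * e0 < 2 ^ J1"
    unfolding J1_def by (rule LeastI[of "\<lambda>j. N * e0 < 2 ^ j", OF J0])
  have "J1 \<noteq> 0"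
    using J1 e0(2) by (intro notI) simp
  then obtain J where J: "J1 = Suc J"
    by (cases J1) auto
  have Jle: "2 ^ J \<le> N * e0"
    using not_less_Least[of J "\<lambda>j. N * e0 < 2 ^ j"] J unfolding J1_def by simp
  have Jgt: "N * e0 < 2 ^ Suc J"
    using J J1 by simp
  define B where "B j = ball x (2 ^ Suc j / N)" for j
  have [measurable]: "B j \<in> sets borel" for j
    by (simp add: B_def)
  define g where "g z = C * N * ((\<Sum>j<J. (1 / 4) ^ j * indicator (B j) z) + (1 / 4) ^ J)" for z
  have intg: "integrable \<nu> g"
    unfolding g_def
    by (intro integrable_mult_right Bochner_Integration.integrable_add
        Bochner_Integration.integrable_sum integrable_real_indicator)
      (auto simp: emeasure_eq_measure less_top[symmetric])
  have "(LINT z|\<nu>. k z) \<le> (LINT z|\<nu>. g z)"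
  proof (rule integral_mono_AE)
    show "integrable \<nu> k"
    proof (rule integrable_const_bound)
      show "AE z in \<nu>. norm (k z) \<le> C * N"
        using bound by eventually_elim auto
    qed measurable
    show "AE z in \<nu>. k z \<le> g z"
      using bound
    proof eventually_elim
      case (elim z)
      show ?case
      proof (cases "C = 0")
        case True
        then show ?thesis
          using elim by (simp add: g_def)
      next
        case False
        with C N have CN: "0 < C * N" by simp
        \<comment> \<open>\<open>dyadic_bound\<close> is applied to u = k z/(C N) and s = N |z -
          x|.\<close>
        have "k z / (C * N) * (N * norm (z - x))\<^sup>2 = k z * N * (norm (z - x))\<^sup>2 / C"
          using False N by (simp add: field_simps power2_eq_square)
        also have "\<dots> \<le> 1"
          using elim C False by (simp add: field_simps)
        finally have "k z / (C * N)
            \<le> (\<Sum>j<J. (1 / 4) ^ j * of_bool (N * norm (z - x) < 2 ^ Suc j)) + (1 / 4) ^ J"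
          by (rule dyadic_bound[rotated]) (use elim CN in simp)
        also have "(\<lambda>j. of_bool (N * norm (z - x) < 2 ^ Suc j) :: real) = (\<lambda>j. indicator (B j) z)"
          using N by (intro ext) (auto simp: B_def indicator_def dist_norm norm_minus_commute field_simps)
        finally show ?thesis
          using CN by (simp add: g_def field_simps)
      qed
    qed
  qed fact
  also have "\<dots> = C * N * ((\<Sum>j<J. (1 / 4) ^ j * measure \<nu> (B j)) + (1 / 4) ^ J * measure \<nu> UNIV)"
  proof -
    have int: "integrable \<nu> (\<lambda>z. (1 / 4 :: real) ^ j * indicator (B j) z)" for j
      by (intro integrable_mult_right integrable_real_indicator) (auto simp: emeasure_eq_measure)
    have "(LINT z|\<nu>. (\<Sum>j<J. (1 / 4 :: real) ^ j * indicator (B j) z) + (1 / 4) ^ J)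
        = (LINT z|\<nu>. (\<Sum>j<J. (1 / 4 :: real) ^ j * indicator (B j) z)) + (LINT z|\<nu>. (1 / 4) ^ J)"
      by (intro Bochner_Integration.integral_add Bochner_Integration.integrable_sum int) simp
    also have "(LINT z|\<nu>. (\<Sum>j<J. (1 / 4 :: real) ^ j * indicator (B j) z))
        = (\<Sum>j<J. LINT z|\<nu>. (1 / 4 :: real) ^ j * indicator (B j) z)"
      by (intro Bochner_Integration.integral_sum int)
    finally show ?thesis
      unfolding g_def by (simp add: mult.commute)
  qed
  also have "\<dots> \<le> C * N * ((\<Sum>j<J. (2 * \<eta> / N) * (1 / 2) ^ j) + 4 / (N * e0)\<^sup>2 * measure \<nu> UNIV)"
  proof (intro mult_left_mono add_mono sum_mono mult_right_mono)
    fix j assume "j \<in> {..<J}"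
    then have "(2 :: real) ^ Suc j \<le> 2 ^ J"
      by (intro power_increasing) auto
    then have "2 ^ Suc j / N \<le> e0"
      using Jle N by (simp add: field_simps)
    then have "measure \<nu> (B j) \<le> \<eta> * (2 ^ Suc j / N)"
      unfolding B_def using N by (intro small) auto
    then have "(1 / 4) ^ j * measure \<nu> (B j) \<le> (1 / 4) ^ j * (\<eta> * (2 ^ Suc j / N))"
      by (intro mult_left_mono) auto
    also have "\<dots> = (2 * \<eta> / N) * ((1 / 4) ^ j * 2 ^ j)"
      by simp
    also have "(1 / 4 :: real) ^ j * 2 ^ j = (1 / 2) ^ j"
      by (simp add: power_mult_distrib[symmetric])
    finally show "(1 / 4) ^ j * measure \<nu> (B j) \<le> (2 * \<eta> / N) * (1 / 2) ^ j" .
  next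
    have "(N * e0)\<^sup>2 \<le> (2 ^ Suc J)\<^sup>2"
      using Jgt e0 N by (intro power_mono) auto
    also have "\<dots> = 4 * 4 ^ J"
      by (subst two_power_square) simp
    finally show "(1 / 4) ^ J \<le> 4 / (N * e0)\<^sup>2"
      using N e0 by (simp add: field_simps power_divide)
  qed (use C N in auto)
  also have "(\<Sum>j<J. (2 * \<eta> / N) * (1 / 2) ^ j) \<le> 4 * \<eta> / N"
  proof -
    have "(\<Sum>j<J. (1 / 2 :: real) ^ j) \<le> 2"
      by (simp add: geometric_sum)
    then have "(2 * \<eta> / N) * (\<Sum>j<J. (1 / 2) ^ j) \<le> (2 * \<eta> / N) * 2"
      using \<eta> N by (intro mult_left_mono) auto
    then show ?thesis
      by (simp add: sum_distrib_left)
  qed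
  also have "C * N * (4 * \<eta> / N + 4 / (N * e0)\<^sup>2 * measure \<nu> UNIV)
      = 4 * C * \<eta> + 4 * C * measure \<nu> UNIV / (N * e0\<^sup>2)"
    using N e0 by (simp add: field_simps power2_eq_square)
  finally show ?thesis
    using C N by (simp add: mult_left_mono)
qed

text \<open>The shape shared by the Fejer kernel and by the Poisson kernel at distance of order 1/n
  from \<open>x\<close>: height O(n), decay O(1/(n |z - x|^2)). The bounds exclude
  \<open>n = 0\<close>, where the division convention puts the Poisson evaluation point on the
  circle.\<close>

definition peak_kernel :: "complex \<Rightarrow> (nat \<Rightarrow> complex \<Rightarrow> real) \<Rightarrow> bool" where
  "peak_kernel x k \<longleftrightarrow> (\<forall>n. k n \<in> borel_measurable borel) \<and>
     (\<exists>C\<ge>0. \<forall>n>0. \<forall>z. norm z = 1 \<longrightarrow>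
        0 \<le> k n z \<and> k n z \<le> C * real n \<and> k n z * real n * (norm (z - x))\<^sup>2 \<le> C)"

lemma peak_kernel_integral_tendsto_0:
  assumes fin: "finite_measure \<nu>" and sets: "sets \<nu> = sets borel"
    and circ: "AE z in \<nu>. norm z = 1"
    and small: "\<And>\<eta>. 0 < \<eta> \<Longrightarrow> eventually (\<lambda>e. measure \<nu> (ball x e) \<le> \<eta> * e) (at_right 0)"
    and k: "peak_kernel x k"
  shows "(\<lambda>n. LINT z|\<nu>. k n z) \<longlonglongrightarrow> 0"
proof -
  obtain C where C: "0 \<le> C" and kC: "\<And>n z. n > 0 \<Longrightarrow> norm z = 1 \<Longrightarrow>
      0 \<le> k n z \<and> k n z \<le> C * real n \<and> k n z * real n * (norm (z - x))\<^sup>2 \<le> C"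
    and meas: "\<And>n. k n \<in> borel_measurable borel"
    using k unfolding peak_kernel_def by blast
  have bound: "AE z in \<nu>. 0 \<le> k n z \<and> k n z \<le> C * real n \<and> k n z * real n * (norm (z - x))\<^sup>2 \<le> C"
    if "n > 0" for n
    using circ by eventually_elim (rule kC[OF that])
  have nonneg: "0 \<le> (LINT z|\<nu>. k n z)" if "n > 0" for n
    by (rule integral_nonneg_AE) (use bound[OF that] in \<open>auto elim!: eventually_mono\<close>)
  show ?thesis
  proof (rule LIMSEQ_I)
    fix r :: real assume r: "0 < r"
    \<comment> \<open>With this \<eta> the dyadic part stays below r/2, also when
      \<open>C = 0\<close>; the tail is allowed r/4.\<close>
    define \<eta> where "\<eta> = r / (8 * (C + 1))"
    have \<eta>: "0 < \<eta>" "4 * C * \<eta> < r / 2 + r / 4"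
      using r C mult_nonneg_nonneg[of C r] by (auto simp: \<eta>_def field_simps add_pos_nonneg)
    obtain b where b: "b > 0" "\<And>e. 0 < e \<Longrightarrow> e < b \<Longrightarrow> measure \<nu> (ball x e) \<le> \<eta> * e"
      using small[OF \<eta>(1)] unfolding eventually_at_right_field by auto
    define e0 where "e0 = b / 2"
    have e0: "0 < e0" "e0 < b"
      using b by (auto simp: e0_def)
    have "(\<lambda>n. 4 * C * measure \<nu> UNIV / (real n * e0\<^sup>2)) \<longlonglongrightarrow> 0"
      using e0 by real_asymp
    then have "eventually (\<lambda>n. 4 * C * measure \<nu> UNIV / (real n * e0\<^sup>2) < r / 4) sequentially"
      using r by (intro order_tendstoD(2)[where y = 0]) auto
    moreover have "eventually (\<lambda>n. 1 \<le> real n * e0) sequentially"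
      using e0 by real_asymp
    moreover have "eventually (\<lambda>n::nat. n > 0) sequentially"
      by (rule eventually_gt_at_top)
    ultimately have "eventually (\<lambda>n. norm ((LINT z|\<nu>. k n z) - 0) < r) sequentially"
    proof eventually_elim
      case (elim n)
      have "(LINT z|\<nu>. k n z) \<le> 4 * C * \<eta> + 4 * C * measure \<nu> UNIV / (real n * e0\<^sup>2)"
        by (rule kernel_integral_le[OF fin sets meas C _ bound])
          (use elim e0 \<eta> b in auto)
      then show ?case
        using elim \<eta> nonneg[of n] by simp
    qed
    then show "\<exists>no. \<forall>n\<ge>no. norm ((LINT z|\<nu>. k n z) - 0) < r"
      by (simp add: eventually_sequentially)
  qed
qed

text \<open>Passes from comparison with arc length to comparison with the radius, the form that the
  dyadic estimate takes. The 8 is the constant of the arc bound; positivity of arc mass lets the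
  quotient be cleared.\<close>

lemma ratio_small_imp_measure_small:
  assumes x: "norm x = 1"
    and lim: "((\<lambda>e. measure \<nu> (ball x e) / measure circle_measure (ball x e)) \<longlongrightarrow> 0) (at_right 0)"
    and \<eta>: "0 < \<eta>"
  shows "eventually (\<lambda>e. measure \<nu> (ball x e) \<le> \<eta> * e) (at_right 0)"
proof -
  have "eventually (\<lambda>e. measure \<nu> (ball x e) / measure circle_measure (ball x e) < \<eta> / 8) (at_right 0)"
    using lim \<eta> by (intro order_tendstoD(2)[where y = 0]) auto
  moreover have "eventually (\<lambda>e::real. 0 < e) (at_right 0)"
    by (rule eventually_at_right_less)
  ultimately show ?thesis
  proof eventually_elim
    case (elim e)
    have "measure \<nu> (ball x e) \<le> \<eta> / 8 * measure circle_measure (ball x e)"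
      using elim measure_circle_ball_pos[OF x, of e] by (simp add: field_simps)
    also have "\<dots> \<le> \<eta> / 8 * (8 * e)"
      using measure_circle_ball_le[OF x, of e] elim \<eta> by (intro mult_left_mono) auto
    finally show ?case
      by simp
  qed
qed

text \<open>The Lebesgue point condition says that the measure |h - h x| dm has little mass on small
  arcs, so the estimate for small measures applies to it; unit mass of the kernel then turns it into
  convergence to \<open>h x\<close>.\<close>

lemma peak_kernel_Lebesgue_point:
  fixes h :: "complex \<Rightarrow> real"
  assumes x: "norm x = 1" and h: "integrable circle_measure h"
    and lim: "((\<lambda>\<epsilon>. 1 / measure circle_measure (ball x \<epsilon>) *
            (LINT z:ball x \<epsilon>|circle_measure. \<bar>h z - h x\<bar>)) \<longlongrightarrow> 0) (at_right 0)"
    and k: "peak_kernel x k" and one: "\<And>n. n > 0 \<Longrightarrow> (LINT z|circle_measure. k n z) = 1"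
  shows "(\<lambda>n. LINT z|circle_measure. k n z * h z) \<longlonglongrightarrow> h x"
proof -
  have hm [measurable]: "h \<in> borel_measurable borel"
    using borel_measurable_integrable[OF h] by simp
  define d where "d z = \<bar>h z - h x\<bar>" for z
  have dint: "integrable circle_measure d"
    unfolding d_def using h by simp
  have dm [measurable]: "d \<in> borel_measurable borel"
    unfolding d_def by measurable
  define \<nu> where "\<nu> = density circle_measure (\<lambda>z. ennreal (d z))"
  have sets: "sets \<nu> = sets borel"
    by (simp add: \<nu>_def)
  have fin: "finite_measure \<nu>"
  proof (rule finite_measureI)
    have "emeasure \<nu> (space \<nu>) = (\<integral>\<^sup>+z. ennreal (d z) \<partial>circle_measure)"
      by (simp add: \<nu>_def emeasure_density)
    also have "\<dots> = ennreal (LINT z|circle_measure. d z)"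
      by (rule nn_integral_eq_integral[OF dint]) (auto simp: d_def)
    finally show "emeasure \<nu> (space \<nu>) \<noteq> \<infinity>"
      by simp
  qed
  have circ: "AE z in \<nu>. norm z = 1"
    unfolding \<nu>_def using AE_circle_norm by (subst AE_density) (auto elim!: eventually_mono)
  have \<nu>ball: "measure \<nu> (ball x e) = (LINT z:ball x e|circle_measure. \<bar>h z - h x\<bar>)" for e
  proof -
    have int: "integrable circle_measure (\<lambda>z. indicator (ball x e) z * d z)"
      using integrable_mult_indicator[OF _ dint, of "ball x e"] by simp
    have "emeasure \<nu> (ball x e) = (\<integral>\<^sup>+z. ennreal (indicator (ball x e) z * d z) \<partial>circle_measure)"
      by (auto simp: \<nu>_def emeasure_density indicator_def intro!: nn_integral_cong)
    also have "\<dots> = ennreal (LINT z|circle_measure. indicator (ball x e) z * d z)"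
      by (rule nn_integral_eq_integral[OF int]) (auto simp: d_def)
    finally show ?thesis
      by (auto simp: measure_def set_lebesgue_integral_def d_def)
  qed
  have \<nu>lim: "(\<lambda>n. LINT z|\<nu>. k n z) \<longlonglongrightarrow> 0"
  proof (rule peak_kernel_integral_tendsto_0[OF fin sets circ _ k])
    show "eventually (\<lambda>e. measure \<nu> (ball x e) \<le> \<eta> * e) (at_right 0)" if "0 < \<eta>" for \<eta>
      by (rule ratio_small_imp_measure_small[OF x _ that]) (use lim in \<open>simp add: \<nu>ball\<close>)
  qed
  have km [measurable]: "k n \<in> borel_measurable borel" for n
    using k by (auto simp: peak_kernel_def)
  obtain C where C: "\<And>n z. n > 0 \<Longrightarrow> norm z = 1 \<Longrightarrow> 0 \<le> k n z \<and> k n z \<le> C * real n"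
    using k unfolding peak_kernel_def by blast
  have kint: "integrable circle_measure (\<lambda>z. k n z * f z)"
    if n: "n > 0" and f: "integrable circle_measure f" for n and f :: "complex \<Rightarrow> real"
  proof (rule Bochner_Integration.integrable_bound)
    show "integrable circle_measure (\<lambda>z. (C * real n) * f z)"
      using f by simp
    show "AE z in circle_measure. norm (k n z * f z) \<le> norm (C * real n * f z)"
      using AE_circle_norm
    proof eventually_elim
      case (elim z)
      then have "\<bar>k n z\<bar> \<le> \<bar>C * real n\<bar>"
        using C[OF n, of z] by auto
      then show ?case
        by (simp add: abs_mult mult_right_mono)
    qed
    show "(\<lambda>z. k n z * f z) \<in> borel_measurable circle_measure"
      using f by measurable
  qed
  have \<nu>int: "(LINT z|\<nu>. k n z) = (LINT z|circle_measure. k n z * d z)" for n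
    unfolding \<nu>_def by (subst integral_density) (auto simp: d_def mult.commute)
  have "norm ((LINT z|circle_measure. k n z * h z) - h x) \<le> (LINT z|\<nu>. k n z)" if n: "n > 0" for n
  proof -
    have "(LINT z|circle_measure. k n z * h z) - h x
        = (LINT z|circle_measure. k n z * h z) - (LINT z|circle_measure. k n z * h x)"
      using one[OF n] by simp
    also have "\<dots> = (LINT z|circle_measure. k n z * h z - k n z * h x)"
      by (rule Bochner_Integration.integral_diff[symmetric])
        (intro kint n h, intro kint n, simp)
    also have "norm \<dots> \<le> (LINT z|circle_measure. norm (k n z * h z - k n z * h x))"
      by (rule integral_norm_bound)
    also have "\<dots> = (LINT z|circle_measure. k n z * d z)"
    proof (rule integral_cong_AE)
      show "AE z in circle_measure. norm (k n z * h z - k n z * h x) = k n z * d z"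
        using AE_circle_norm
        by eventually_elim (use C[OF n] in \<open>auto simp: d_def right_diff_distrib[symmetric] abs_mult\<close>)
    qed auto
    finally show ?thesis
      by (simp add: \<nu>int)
  qed
  then have "(\<lambda>n. (LINT z|circle_measure. k n z * h z) - h x) \<longlonglongrightarrow> 0"
    by (intro Lim_null_comparison[OF _ \<nu>lim]) (auto intro: eventually_mono[OF eventually_gt_at_top[of 0]])
  then show ?thesis
    by (simp add: LIM_zero_iff)
qed

section \<open>The Fejer and Poisson kernels\<close>

lemma cnj_mult_self_of_norm_1: "norm z = 1 \<Longrightarrow> cnj z * z = 1" "norm z = 1 \<Longrightarrow> z * cnj z = 1"
  by (metis complex_norm_square mult.commute of_real_1 power_one)+

definition fejer :: "nat \<Rightarrow> complex \<Rightarrow> real" where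
  "fejer n z = (norm (\<Sum>j<n. z ^ j))\<^sup>2 / real n"

lemma continuous_on_fejer [continuous_intros]:
  "continuous_on A f \<Longrightarrow> continuous_on A (\<lambda>z. fejer n (f z))"
  unfolding fejer_def by (cases "n = 0") (auto intro!: continuous_intros)

lemma borel_measurable_fejer [measurable]: "fejer n \<in> borel_measurable borel"
  by (intro borel_measurable_continuous_onI continuous_intros)

lemma fejer_nonneg: "0 \<le> fejer n z"
  by (simp add: fejer_def)

lemma integral_fejer:
  assumes "norm x = 1" "n > 0"
  shows "(LINT z|circle_measure. fejer n (cnj x * z)) = 1"
  unfolding fejer_def using integral_geometric_sum_norm_square[of "cnj x" n] assms by simp

lemma fejer_le:
  assumes "norm z = 1" shows "fejer n z \<le> real n"
proof -
  have "norm (\<Sum>j<n. z ^ j) \<le> (\<Sum>j<n. 1)"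
    by (intro sum_norm_le) (use assms in \<open>simp add: norm_power\<close>)
  then have "(norm (\<Sum>j<n. z ^ j))\<^sup>2 \<le> (real n)\<^sup>2"
    by (intro power_mono) auto
  then show ?thesis
    by (cases "n = 0") (auto simp: fejer_def field_simps power2_eq_square)
qed

text \<open>Decay holds because (1 - u) times the geometric sum is 1 - u^n, of modulus at most 2;
  the square of this bound is the constant 4.\<close>

lemma peak_kernel_fejer:
  assumes x: "norm x = 1"
  shows "peak_kernel x (\<lambda>n z. fejer n (cnj x * z))"
  unfolding peak_kernel_def
proof (intro conjI allI exI[of _ 4] impI)
  fix n :: nat and z :: complex
  assume n: "n > 0" and z: "norm z = 1"
  define u where "u = cnj x * z"
  have u: "norm u = 1"
    using x z by (simp add: u_def norm_mult)
  show "fejer n (cnj x * z) \<le> 4 * real n"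
    using fejer_le[OF u, of n] by (simp add: u_def)
  have "x * u = z"
    by (simp add: u_def mult.assoc[symmetric] cnj_mult_self_of_norm_1[OF x])
  then have "z - x = x * (u - 1)"
    by (simp add: right_diff_distrib)
  then have zx: "norm (z - x) = norm (1 - u)"
    using x by (simp add: norm_mult norm_minus_commute)
  have "norm (1 - u) * norm (\<Sum>j<n. u ^ j) = norm (1 - u ^ n)"
    by (simp add: norm_mult[symmetric] one_diff_power_eq)
  also have "\<dots> \<le> 2"
    using norm_triangle_ineq4[of 1 "u ^ n"] u by (simp add: norm_power)
  finally have "(norm (1 - u) * norm (\<Sum>j<n. u ^ j))\<^sup>2 \<le> 2\<^sup>2"
    by (intro power_mono) auto
  then show "fejer n (cnj x * z) * real n * (norm (z - x))\<^sup>2 \<le> 4"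
    using n unfolding zx by (simp add: fejer_def u_def power_mult_distrib mult.commute)
qed (auto simp: fejer_nonneg)

definition poisson :: "complex \<Rightarrow> complex \<Rightarrow> real" where
  "poisson a z = (1 - (norm a)\<^sup>2) / (norm (z - a))\<^sup>2"

lemma borel_measurable_poisson [measurable]: "poisson a \<in> borel_measurable borel"
  unfolding poisson_def by measurable

lemma continuous_on_poisson: "norm a < 1 \<Longrightarrow> continuous_on (sphere 0 1) (poisson a)"
  unfolding poisson_def by (intro continuous_intros) auto

lemma poisson_nonneg: "norm a < 1 \<Longrightarrow> 0 \<le> poisson a z"
  unfolding poisson_def by (simp add: power_le_one)

lemma one_minus_cnj_mult_nonzero:
  assumes a: "norm a < 1" and z: "norm z \<le> 1"
  shows "1 - cnj a * z \<noteq> 0"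
proof
  assume "1 - cnj a * z = 0"
  then have "norm (cnj a * z) = 1"
    by simp
  moreover have "norm a * norm z \<le> norm a * 1"
    using z by (intro mult_left_mono) auto
  ultimately show False
    using a by (simp add: norm_mult)
qed

text \<open>On the circle the Poisson kernel splits into z/(z - a) and cnj a z/(1 - cnj a z). The
  first reproduces f(a) by Cauchy's formula; the second times \<open>f\<close> is holomorphic in the
  disc and vanishes at 0, so its mean is zero.\<close>

lemma integral_poisson_holomorphic:
  fixes f :: "complex \<Rightarrow> complex"
  assumes cont: "continuous_on (cball 0 1) f" and hol: "f holomorphic_on ball 0 1"
    and a: "norm a < 1" and f [measurable]: "f \<in> borel_measurable borel"
  shows "(LINT z|circle_measure. complex_of_real (poisson a z) * f z) = f a"
proof -
  note nz = one_minus_cnj_mult_nonzero[OF a]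
  have contS: "continuous_on (sphere 0 1) f"
    by (rule continuous_on_subset[OF cont]) auto
  define g1 where "g1 z = f z * z / (z - a)" for z
  define g2 where "g2 z = f z * (cnj a * z) / (1 - cnj a * z)" for z
  have [measurable]: "g1 \<in> borel_measurable borel" "g2 \<in> borel_measurable borel"
    unfolding g1_def g2_def by measurable
  have "(LINT z|circle_measure. g1 z) = f a"
    by (rule Cauchy_circle_measure[OF cont hol a]) (auto simp: g1_def)
  moreover have "(LINT z|circle_measure. g2 z) = g2 0"
  proof (rule Cauchy_circle_measure[where f = g2 and a = 0])
    show "continuous_on (cball 0 1) g2"
      unfolding g2_def by (intro continuous_intros cont) (use nz in auto)
    show "g2 holomorphic_on ball 0 1"
      unfolding g2_def by (intro holomorphic_intros hol) (use nz in auto)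
  qed auto
  moreover have "g2 0 = 0"
    by (simp add: g2_def)
  moreover have "integrable circle_measure g1"
    by (rule integrable_circle_measure)
      (use a in \<open>auto simp: g1_def intro!: continuous_intros contS\<close>)
  moreover have "integrable circle_measure g2"
    by (rule integrable_circle_measure)
      (use nz in \<open>auto simp: g2_def intro!: continuous_intros contS\<close>)
  ultimately have "(LINT z|circle_measure. g1 z + g2 z) = f a"
    by simp
  moreover have "(LINT z|circle_measure. g1 z + g2 z)
      = (LINT z|circle_measure. complex_of_real (poisson a z) * f z)"
  proof (rule integral_cong_AE)
    show "AE z in circle_measure. g1 z + g2 z = complex_of_real (poisson a z) * f z"
      using AE_circle_norm
    proof eventually_elim
      case (elim z)
      have zc: "z * cnj z = 1"
        using cnj_mult_self_of_norm_1[OF elim] by simp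
      have nz1: "z - a \<noteq> 0" and nz2: "1 - cnj a * z \<noteq> 0" and "z \<noteq> 0"
        using elim a nz[of z] by auto
      have "complex_of_real ((norm (z - a))\<^sup>2) = (z - a) * (cnj z - cnj a)"
          by (subst complex_norm_square) simp
      also have "cnj z - cnj a = (1 - cnj a * z) / z"
        using \<open>z \<noteq> 0\<close> zc by (simp add: eq_divide_eq left_diff_distrib right_diff_distrib mult.commute)
      finally have "complex_of_real (poisson a z)
          = (1 - a * cnj a) * z / ((z - a) * (1 - cnj a * z))"
        unfolding poisson_def of_real_divide of_real_diff of_real_1
        using \<open>z \<noteq> 0\<close> by (simp only: complex_norm_square) simp
      also have "\<dots> = z / (z - a) + cnj a * z / (1 - cnj a * z)"
        by (subst add_frac_eq[OF nz1 nz2]) (simp add: algebra_simps)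
      finally have K: "complex_of_real (poisson a z) = z / (z - a) + cnj a * z / (1 - cnj a * z)" .
      show ?case
        by (simp add: K g1_def g2_def distrib_left distrib_right mult_ac)
    qed
  qed auto
  ultimately show ?thesis
    by simp
qed

lemma integral_poisson:
  assumes a: "norm a < 1"
  shows "(LINT z|circle_measure. poisson a z) = 1"
proof -
  have "complex_of_real (LINT z|circle_measure. poisson a z)
      = (LINT z|circle_measure. complex_of_real (poisson a z) * 1)"
    by simp
  also have "\<dots> = 1"
    by (rule integral_poisson_holomorphic) (use a in auto)
  finally show ?thesis
    using of_real_eq_1_iff by blast
qed

lemma integral_poisson_Re:
  fixes f :: "complex \<Rightarrow> complex"
  assumes cont: "continuous_on (cball 0 1) f" and hol: "f holomorphic_on ball 0 1"
    and a: "norm a < 1" and f: "f \<in> borel_measurable borel"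
  shows "(LINT z|circle_measure. poisson a z * Re (f z)) = Re (f a)"
proof -
  have "integrable circle_measure (\<lambda>z. complex_of_real (poisson a z) * f z)"
    using f continuous_on_poisson[OF a] continuous_on_subset[OF cont, of "sphere 0 1"]
    by (intro integrable_circle_measure continuous_intros) auto
  then have "(LINT z|circle_measure. Re (complex_of_real (poisson a z) * f z))
      = Re (LINT z|circle_measure. complex_of_real (poisson a z) * f z)"
    by (rule integral_Re)
  then show ?thesis
    using integral_poisson_holomorphic[OF assms] by simp
qed

text \<open>On the circle |z - a| is at least \<delta>/n and at least |z - x|/2, while 1 - |a|^2
  \<le> 2 \<delta>/n. The height is thus at most 2 n/\<delta>, the decay constant at most 8
  \<delta>, and 8/\<delta> dominates both because \<delta> \<le> 1.\<close>

lemma peak_kernel_poisson: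
  assumes x: "norm x = 1" and d: "0 < \<delta>" "\<delta> \<le> 1"
  shows "peak_kernel x (\<lambda>n. poisson (of_real (1 - \<delta> / real n) * x))"
  unfolding peak_kernel_def
proof (intro conjI allI exI[of _ "8 / \<delta>"] impI)
  show "0 \<le> 8 / \<delta>"
    using d by simp
  fix n :: nat and z :: complex
  assume n: "n > 0" and z: "norm z = 1"
  define r where "r = 1 - \<delta> / real n"
  define a where "a = of_real r * x"
  have r: "0 \<le> r" "r < 1" and r1: "1 - r = \<delta> / real n"
    using n d by (auto simp: r_def field_simps)
  have na: "norm a = r"
    using x r by (simp add: a_def norm_mult)
  have ge1: "\<delta> / real n \<le> norm (z - a)"
    using norm_triangle_ineq2[of z a] z na r1 by simp
  have dn: "0 < \<delta> / real n"
    using d n by simp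
  then have pos: "0 < norm (z - a)"
    using ge1 by linarith
  have "x - a = of_real (1 - r) * x"
    by (simp add: a_def algebra_simps)
  then have "norm (x - a) = 1 - r"
    using x r by (simp only: norm_mult norm_of_real) simp
  then have ge2: "norm (z - x) \<le> 2 * norm (z - a)"
    using norm_triangle_ineq4[of "z - a" "x - a"] ge1 r1 by simp
  have "1 - r\<^sup>2 = (1 - r) * (1 + r)"
    by (simp add: power2_eq_square algebra_simps)
  also have "\<dots> \<le> (1 - r) * 2"
    using r by (intro mult_left_mono) auto
  finally have num: "1 - r\<^sup>2 \<le> 2 * (\<delta> / real n)"
    using r1 by (simp add: mult.commute)
  have num0: "0 \<le> 1 - r\<^sup>2"
    using r by (simp add: power_le_one)
  have P: "poisson a z = (1 - r\<^sup>2) / (norm (z - a))\<^sup>2"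
    by (simp add: poisson_def na)
  show "0 \<le> poisson (complex_of_real (1 - \<delta> / real n) * x) z"
    using num0 P unfolding a_def r_def by simp
  have "poisson a z \<le> 2 * (\<delta> / real n) / (\<delta> / real n)\<^sup>2"
    unfolding P using num num0 ge1 dn pos by (intro frac_le power_mono zero_less_power) auto
  also have "\<dots> = 2 / \<delta> * real n"
    using d n by (simp add: field_simps power2_eq_square)
  also have "\<dots> \<le> 8 / \<delta> * real n"
    using d by (intro mult_right_mono divide_right_mono) auto
  finally show "poisson (complex_of_real (1 - \<delta> / real n) * x) z \<le> 8 / \<delta> * real n"
    unfolding a_def r_def .
  have "(norm (z - x))\<^sup>2 \<le> (2 * norm (z - a))\<^sup>2"
    using ge2 by (intro power_mono) auto
  then have "poisson a z * real n * (norm (z - x))\<^sup>2 \<le> poisson a z * real n * (2 * norm (z - a))\<^sup>2"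
    using P num0 by (intro mult_left_mono) auto
  also have "\<dots> = 4 * (1 - r\<^sup>2) * real n"
    unfolding P using pos by (simp add: field_simps power2_eq_square)
  also have "\<dots> \<le> 4 * (2 * (\<delta> / real n)) * real n"
    using num by (intro mult_right_mono mult_left_mono) auto
  also have "\<dots> = 8 * \<delta>"
    using n by simp
  also have "\<dots> \<le> 8 / \<delta>"
    using d by (simp add: field_simps mult_le_one)
  finally show "poisson (complex_of_real (1 - \<delta> / real n) * x) z * real n * (norm (z - x))\<^sup>2 \<le> 8 / \<delta>"
    unfolding a_def r_def .
qed auto

section \<open>An upper bound for polynomials inside the disc\<close>

lemma borel_measurable_cnj [measurable]: "cnj \<in> borel_measurable borel"
  by (intro borel_measurable_continuous_onI continuous_intros)

text \<open>Controls a phase by the distance of \<open>x\<close> to 1. For |x| < 1/2 the left side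
  is at most 2 while |x - 1| exceeds 1/2; otherwise the division by |x| costs at most a factor
  2.\<close>

lemma norm_unimodular_quotient_le:
  fixes x :: complex
  assumes "x \<noteq> 0"
  shows "norm (1 - cnj x / x) \<le> 4 * norm (x - 1)"
proof (cases "norm x < 1 / 2")
  case True
  have "norm (1 - cnj x / x) \<le> 1 + norm (cnj x / x)"
    using norm_triangle_ineq4[of 1 "cnj x / x"] by simp
  also have "\<dots> = 2"
    using assms by (simp add: norm_divide)
  finally show ?thesis
    using True norm_triangle_ineq4[of x "x - 1"] by simp
next
  case False
  have "norm (1 - cnj x / x) = norm ((x - 1) - cnj (x - 1)) / norm x"
    using assms by (simp add: norm_divide[symmetric] diff_divide_distrib)
  also have "\<dots> \<le> (2 * norm (x - 1)) / (1 / 2)"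
    using norm_triangle_ineq4[of "x - 1" "cnj (x - 1)"] False
    by (intro frac_le) (auto simp del: complex_cnj_diff)
  finally show ?thesis
    by simp
qed

text \<open>As \<open>degree P < n\<close> is strict, P(z) z^-n is on the circle the conjugate of a
  polynomial without constant term, and z/(z - a) is the conjugate of 1/(1 - cnj a z). The integrand
  is the conjugate of a function that is holomorphic in the disc and vanishes at 0.\<close>

lemma integral_antianalytic_eq_0:
  fixes D :: "complex \<Rightarrow> complex" and P :: "complex poly"
  assumes D: "D holomorphic_on UNIV" and P: "degree P < n" and a: "norm a < 1"
  shows "(LINT z|circle_measure. poly P z * cnj (D z) * cnj z ^ n * z / (z - a)) = 0"
proof -
  have contD: "continuous_on A D" for A
    using D by (meson continuous_on_subset holomorphic_on_imp_continuous_on subset_UNIV)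
  have [measurable]: "D \<in> borel_measurable borel"
    using contD by (rule borel_measurable_continuous_onI)
  have [measurable]: "poly P \<in> borel_measurable borel"
    by (intro borel_measurable_continuous_onI continuous_intros)
  define R where "R z = (\<Sum>i<n. cnj (coeff P i) * z ^ (n - i))" for z
  define G where "G z = R z * D z / (1 - cnj a * z)" for z
  have contR: "continuous_on A R" for A
    unfolding R_def by (intro continuous_intros)
  have [measurable]: "R \<in> borel_measurable borel"
    using contR by (rule borel_measurable_continuous_onI)
  have [measurable]: "G \<in> borel_measurable borel"
    unfolding G_def by measurable
  note nz = one_minus_cnj_mult_nonzero[OF a]
  have "(LINT z|circle_measure. G z) = G 0"
  proof (rule Cauchy_circle_measure[where f = G and a = 0])
    show "continuous_on (cball 0 1) G"
      unfolding G_def by (intro continuous_intros contD contR) (use nz in auto)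
    show "G holomorphic_on ball 0 1"
      unfolding G_def R_def
      by (intro holomorphic_intros holomorphic_on_subset[OF D]) (use nz in auto)
  qed auto
  also have "G 0 = 0"
    unfolding G_def R_def by (simp add: sum.neutral)
  finally have "(LINT z|circle_measure. cnj (G z)) = 0"
    by simp
  moreover have "(LINT z|circle_measure. poly P z * cnj (D z) * cnj z ^ n * z / (z - a))
      = (LINT z|circle_measure. cnj (G z))"
  proof (rule integral_cong_AE)
    show "AE z in circle_measure. poly P z * cnj (D z) * cnj z ^ n * z / (z - a) = cnj (G z)"
      using AE_circle_norm
    proof eventually_elim
      case (elim z)
      note zc = cnj_mult_self_of_norm_1[OF elim]
      have "z \<noteq> 0"
        using elim by auto
      have pw: "z ^ i * cnj z ^ n = cnj z ^ (n - i)" if "i < n" for i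
      proof -
        have "z ^ i * cnj z ^ n = (z * cnj z) ^ i * cnj z ^ (n - i)"
          using that by (simp add: power_mult_distrib mult.assoc power_add[symmetric])
        then show ?thesis
          using zc by simp
      qed
      have "poly P z = (\<Sum>i\<le>degree P. coeff P i * z ^ i)"
        by (rule poly_altdef)
      also have "\<dots> = (\<Sum>i<n. coeff P i * z ^ i)"
        by (intro sum.mono_neutral_left) (use P in \<open>auto simp: coeff_eq_0\<close>)
      finally have "poly P z * cnj z ^ n = (\<Sum>i<n. coeff P i * (z ^ i * cnj z ^ n))"
        by (simp add: sum_distrib_right mult.assoc)
      also have "\<dots> = cnj (R z)"
        unfolding R_def cnj_sum by (intro sum.cong) (auto simp: pw)
      finally have R: "poly P z * cnj z ^ n = cnj (R z)" .
      have "z * (1 - a * cnj z) = z - a"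
        using zc by (simp add: right_diff_distrib mult.left_commute)
      then have "z / (z - a) = 1 / (1 - a * cnj z)"
        using \<open>z \<noteq> 0\<close> by (metis nonzero_mult_divide_mult_cancel_left mult.right_neutral)
      then have "poly P z * cnj (D z) * cnj z ^ n * z / (z - a)
          = (poly P z * cnj z ^ n) * cnj (D z) * (1 / (1 - a * cnj z))"
        by (metis (no_types, lifting) mult.assoc mult.commute times_divide_eq_right)
      also have "\<dots> = cnj (G z)"
        by (simp add: R G_def)
      finally show ?case .
    qed
  qed auto
  ultimately show ?thesis
    by simp
qed

text \<open>The geometric sum, at most \<open>n\<close>, is what a constant \<open>D\<close> would
  give and carries the sharp constant. The second root measures, in Poisson mean square, how far
  D/D(a) is from 1.\<close>

lemma christoffel_bound_entire:
  fixes D :: "complex \<Rightarrow> complex" and P :: "complex poly"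
  assumes D: "D holomorphic_on UNIV" and D0: "\<And>z. D z \<noteq> 0"
    and P: "degree P < n" and a: "norm a < 1"
  shows "norm (poly P a) * norm (D a)
    \<le> sqrt (LINT z|circle_measure. (norm (poly P z))\<^sup>2 * (norm (D z))\<^sup>2) *
      (sqrt (\<Sum>j<n. norm a ^ (2 * j)) +
       4 * sqrt (((LINT z|circle_measure. poisson a z * (norm (D z))\<^sup>2) / (norm (D a))\<^sup>2 - 1)
                 / (1 - (norm a)\<^sup>2)))"
proof -
  have contD: "continuous_on A D" for A
    using D by (meson continuous_on_subset holomorphic_on_imp_continuous_on subset_UNIV)
  have Dm [measurable]: "D \<in> borel_measurable borel"
    using contD by (rule borel_measurable_continuous_onI)
  have Pm [measurable]: "poly P \<in> borel_measurable borel"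
    by (intro borel_measurable_continuous_onI continuous_intros)
  have za: "z \<noteq> a" if "norm z = 1" for z
    using a that by auto
  note cint = continuous_intros contD continuous_on_poisson[OF a]
  define x where "x z = D z / D a" for z
  have contx: "continuous_on A x" for A
    unfolding x_def by (intro cint) (use D0 in auto)
  have xm [measurable]: "x \<in> borel_measurable borel"
    unfolding x_def by measurable
  have x0: "x z \<noteq> 0" for z
    by (simp add: x_def D0)
  define f where "f z = norm (poly P z) * norm (D z)" for z
  define S where "S z = norm (\<Sum>j<n. (cnj a * z) ^ j)" for z
  define T where "T z = norm (x z - 1) / norm (z - a)" for z
  have cont: "continuous_on (sphere 0 1) f" "continuous_on (sphere 0 1) S"
      "continuous_on (sphere 0 1) T"
    unfolding f_def S_def T_def by (intro cint contx; use za in auto)+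
  have "continuous_on UNIV (\<lambda>z. \<Sum>j<n. (cnj a * z) ^ j)"
    by (intro continuous_intros)
  then have [measurable]: "(\<lambda>z. \<Sum>j<n. (cnj a * z) ^ j) \<in> borel_measurable borel"
    by (rule borel_measurable_continuous_onI)
  have meas [measurable]: "f \<in> borel_measurable borel" "S \<in> borel_measurable borel"
      "T \<in> borel_measurable borel"
    unfolding f_def S_def T_def by measurable
  have I1: "(LINT z|circle_measure. poly P z * D z * z / (z - a)) = poly P a * D a"
  proof (rule Cauchy_circle_measure[where f = "\<lambda>z. poly P z * D z" and a = a])
    show "(\<lambda>z. poly P z * D z) holomorphic_on ball 0 1"
      by (intro holomorphic_intros holomorphic_on_subset[OF D]) auto
  qed (auto intro!: cint a)
  have int1: "integrable circle_measure (\<lambda>z. poly P z * D z * z / (z - a))"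
    by (intro integrable_circle_measure cint) (use za in auto)
  have int2: "integrable circle_measure (\<lambda>z. poly P z * cnj (D z) * cnj z ^ n * z / (z - a))"
    by (intro integrable_circle_measure cint) (use za in auto)
  \<comment> \<open>With \<open>\<beta>\<close> the two integrands cancel at leading order near \<open>a\<close>, where \<open>D\<close> is close to \<open>D a\<close>.\<close>
  define \<beta> where "\<beta> = a ^ n * D a / cnj (D a)"
  define h where "h z = poly P z * D z * z / (z - a)
      - \<beta> * (poly P z * cnj (D z) * cnj z ^ n * z / (z - a))" for z
  have inth: "integrable circle_measure h"
    unfolding h_def
    by (intro Bochner_Integration.integrable_diff integrable_mult_right int1 int2)
  have Ih: "(LINT z|circle_measure. h z) = poly P a * D a"
    unfolding h_def
    by (subst Bochner_Integration.integral_diff[OF int1 integrable_mult_right[OF int2]])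
      (simp only: integral_mult_right_zero I1 integral_antianalytic_eq_0[OF D P a], simp)
  \<comment> \<open>The last factor of \<open>h\<close> splits into 1 - (a cnj z)^n, which absorbs
    the pole and leaves \<open>S\<close>, and a phase error, which keeps the denominator and leads
    to \<open>T\<close>.\<close>
  have hle: "norm (h z) \<le> f z * S z + 4 * (f z * T z)" if z: "norm z = 1" for z
  proof -
    note zc = cnj_mult_self_of_norm_1[OF z]
    define u where "u = cnj (x z) / x z"
    have "h z = poly P z * D z * z / (z - a) * (1 - (a * cnj z) ^ n * u)"
    proof -
      have "D z * ((a * cnj z) ^ n * u) = \<beta> * (cnj (D z) * cnj z ^ n)"
        using D0 by (simp add: u_def x_def \<beta>_def power_mult_distrib)
      then have "poly P z * z / (z - a) * (D z - D z * ((a * cnj z) ^ n * u)) = h z"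
        by (simp add: h_def right_diff_distrib mult_ac)
      then show ?thesis
        by (simp add: right_diff_distrib diff_divide_distrib mult_ac)
    qed
    then have "norm (h z) = f z / norm (z - a) * norm (1 - (a * cnj z) ^ n * u)"
      using z by (simp add: f_def norm_mult norm_divide)
    moreover have "norm (1 - (a * cnj z) ^ n * u) \<le> norm (z - a) * S z + 4 * norm (x z - 1)"
    proof -
      have "1 - (a * cnj z) ^ n * u = (1 - (a * cnj z) ^ n) + (a * cnj z) ^ n * (1 - u)"
        by (simp add: algebra_simps)
      then have "norm (1 - (a * cnj z) ^ n * u)
          \<le> norm (1 - (a * cnj z) ^ n) + norm ((a * cnj z) ^ n * (1 - u))"
        by (metis norm_triangle_ineq)
      moreover have "norm (1 - (a * cnj z) ^ n) = norm (z - a) * S z"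
      proof -
        have "norm (1 - (a * cnj z) ^ n) = norm (cnj (1 - (a * cnj z) ^ n))"
          by (rule complex_mod_cnj[symmetric])
        also have "cnj (1 - (a * cnj z) ^ n) = (1 - cnj a * z) * (\<Sum>j<n. (cnj a * z) ^ j)"
          by (simp add: one_diff_power_eq)
        also have "norm (1 - cnj a * z) = norm (z - a)"
        proof -
          have "1 - cnj a * z = z * cnj (z - a)"
            using zc by (simp add: right_diff_distrib mult.commute)
          then show ?thesis
            using z by (simp only: norm_mult complex_mod_cnj mult_1_left)
        qed
        then have "norm ((1 - cnj a * z) * (\<Sum>j<n. (cnj a * z) ^ j)) = norm (z - a) * S z"
          by (simp add: norm_mult S_def)
        finally show ?thesis .
      qed
      moreover have "norm ((a * cnj z) ^ n * (1 - u)) \<le> 1 * (4 * norm (x z - 1))"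
        unfolding norm_mult u_def
        by (intro mult_mono norm_unimodular_quotient_le[OF x0])
          (use a z in \<open>auto simp: norm_power norm_mult power_le_one\<close>)
      ultimately show ?thesis
        by simp
    qed
    then have "f z / norm (z - a) * norm (1 - (a * cnj z) ^ n * u)
        \<le> f z / norm (z - a) * (norm (z - a) * S z + 4 * norm (x z - 1))"
      by (intro mult_left_mono) (auto simp: f_def)
    moreover have "f z / norm (z - a) * (norm (z - a) * S z + 4 * norm (x z - 1))
        = f z * S z + 4 * (f z * T z)"
      using za[OF z] by (simp add: T_def field_simps)
    ultimately show ?thesis
      by simp
  qed
  have ints: "integrable circle_measure (\<lambda>z. (f z)\<^sup>2)" "integrable circle_measure (\<lambda>z. (S z)\<^sup>2)"
      "integrable circle_measure (\<lambda>z. (T z)\<^sup>2)" "integrable circle_measure (\<lambda>z. f z * S z)"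
      "integrable circle_measure (\<lambda>z. f z * T z)"
    by (intro integrable_circle_measure continuous_intros cont; measurable)+
  have "norm (poly P a) * norm (D a) = norm (LINT z|circle_measure. h z)"
    by (simp add: Ih norm_mult)
  also have "\<dots> \<le> (LINT z|circle_measure. norm (h z))"
    by (rule integral_norm_bound)
  also have "\<dots> \<le> (LINT z|circle_measure. f z * S z + 4 * (f z * T z))"
  proof (rule integral_mono_AE)
    show "AE z in circle_measure. norm (h z) \<le> f z * S z + 4 * (f z * T z)"
      using AE_circle_norm by eventually_elim (rule hle)
  qed (use inth ints in auto)
  also have "\<dots> = (LINT z|circle_measure. f z * S z) + 4 * (LINT z|circle_measure. f z * T z)"
    using ints by simp
  also have "\<dots> \<le> sqrt (LINT z|circle_measure. (f z)\<^sup>2) * sqrt (LINT z|circle_measure. (S z)\<^sup>2)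
      + 4 * (sqrt (LINT z|circle_measure. (f z)\<^sup>2) * sqrt (LINT z|circle_measure. (T z)\<^sup>2))"
    by (intro add_mono mult_left_mono integral_Cauchy_Schwarz ints) auto
  also have "(LINT z|circle_measure. (S z)\<^sup>2) = (\<Sum>j<n. norm a ^ (2 * j))"
    unfolding S_def by (subst integral_geometric_sum_norm_square) simp
  also have "(LINT z|circle_measure. (T z)\<^sup>2)
      = ((LINT z|circle_measure. poisson a z * (norm (D z))\<^sup>2) / (norm (D a))\<^sup>2 - 1)
        / (1 - (norm a)\<^sup>2)"
  proof -
    have "(norm a)\<^sup>2 < 1"
      using a by (simp add: abs_square_less_1)
    then have a1: "1 - (norm a)\<^sup>2 \<noteq> 0"
      by simp
    \<comment> \<open>\<open>x\<close> is holomorphic with x(a) = 1, so its real part has Poisson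
      mean 1, and expanding |x - 1|^2 leaves the mean of |x|^2 minus 1.\<close>
    have IRe: "(LINT z|circle_measure. poisson a z * Re (x z)) = 1"
    proof -
      have "x holomorphic_on ball 0 1"
        unfolding x_def[abs_def]
        by (intro holomorphic_intros holomorphic_on_subset[OF D]) (use D0 in auto)
      then have "(LINT z|circle_measure. poisson a z * Re (x z)) = Re (x a)"
        by (intro integral_poisson_Re contx a xm)
      then show ?thesis
        by (simp add: x_def D0)
    qed
    have i1: "integrable circle_measure (\<lambda>z. poisson a z * (norm (D z))\<^sup>2)"
      by (intro integrable_circle_measure cint) measurable
    have i2: "integrable circle_measure (\<lambda>z. poisson a z * Re (x z))"
      by (intro integrable_circle_measure cint contx) measurable
    have i3: "integrable circle_measure (poisson a)"
      by (intro integrable_circle_measure cint) measurable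
    have "(T z)\<^sup>2 = (poisson a z * (norm (D z))\<^sup>2 / (norm (D a))\<^sup>2
        - 2 * (poisson a z * Re (x z)) + poisson a z) / (1 - (norm a)\<^sup>2)" for z
    proof -
      have "(norm (x z - 1))\<^sup>2 = (norm (x z))\<^sup>2 - 2 * Re (x z) + 1"
        by (simp only: cmod_power2) (simp add: power2_eq_square algebra_simps)
      also have "(norm (x z))\<^sup>2 = (norm (D z))\<^sup>2 / (norm (D a))\<^sup>2"
        by (simp add: x_def norm_divide power_divide)
      finally have "(T z)\<^sup>2 = ((norm (D z))\<^sup>2 / (norm (D a))\<^sup>2 - 2 * Re (x z) + 1)
          * (poisson a z / (1 - (norm a)\<^sup>2))"
        using a1 by (simp add: T_def power_divide poisson_def)
      then show ?thesis
        by (simp add: algebra_simps add_divide_distrib diff_divide_distrib)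
    qed
    then have "(LINT z|circle_measure. (T z)\<^sup>2)
        = (LINT z|circle_measure. (poisson a z * (norm (D z))\<^sup>2 / (norm (D a))\<^sup>2
        - 2 * (poisson a z * Re (x z)) + poisson a z)) / (1 - (norm a)\<^sup>2)"
      by simp
    also have "(LINT z|circle_measure. (poisson a z * (norm (D z))\<^sup>2 / (norm (D a))\<^sup>2
        - 2 * (poisson a z * Re (x z)) + poisson a z))
        = (LINT z|circle_measure. poisson a z * (norm (D z))\<^sup>2) / (norm (D a))\<^sup>2 - 2 + 1"
      using i1 i2 i3 IRe integral_poisson[OF a] by simp
    finally show ?thesis
      by simp
  qed
  finally show ?thesis
    by (simp add: f_def power_mult_distrib algebra_simps)
qed

section \<open>Fejer means of integrable functions\<close>

lemma fejer_eq_Re: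
  assumes "norm z = 1"
  shows "fejer n z = Re ((of_nat n + 2 * (\<Sum>j<n. \<Sum>k<j. z ^ (j - k))) / of_nat n)"
proof -
  have "(norm (\<Sum>j<n. z ^ j))\<^sup>2 = real n + 2 * Re (\<Sum>j<n. \<Sum>k<j. z ^ (j - k))"
    using geometric_sum_norm_square[OF assms, of 1 n] by simp
  also have "\<dots> = Re (of_nat n + 2 * (\<Sum>j<n. \<Sum>k<j. z ^ (j - k)))"
    by simp
  also have "\<dots> / real n = Re ((of_nat n + 2 * (\<Sum>j<n. \<Sum>k<j. z ^ (j - k))) / of_nat n)"
    by (rule Re_divide_of_nat[symmetric])
  finally show ?thesis
    by (simp add: fejer_def)
qed

definition fejer_mean :: "nat \<Rightarrow> (complex \<Rightarrow> real) \<Rightarrow> complex \<Rightarrow> real" where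
  "fejer_mean n f z = (LINT \<zeta>|circle_measure. fejer n (cnj \<zeta> * z) * f \<zeta>)"

text \<open>As \<open>f\<close> is real, negative Fourier modes are conjugates of positive ones, and
  the Fejer sum is the real part of a polynomial with moments of \<open>f\<close> in its
  coefficients. For \<open>ln w\<close> this makes \<open>exp (H / 2)\<close> an entire zero-free
  substitute for the outer function.\<close>

lemma fejer_mean_eq_Re_entire:
  assumes f: "integrable circle_measure f"
  obtains H where "H holomorphic_on UNIV" "\<And>z. norm z = 1 \<Longrightarrow> Re (H z) = fejer_mean n f z"
proof -
  define c where "c m = (LINT \<zeta>|circle_measure. cnj \<zeta> ^ m * complex_of_real (f \<zeta>))" for m
  define H where "H z = (of_nat n * c 0 + 2 * (\<Sum>j<n. \<Sum>k<j. c (j - k) * z ^ (j - k))) / of_nat n" for z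
  have [measurable]: "f \<in> borel_measurable borel"
    using borel_measurable_integrable[OF f] by simp
  have int: "integrable circle_measure (\<lambda>\<zeta>. cnj \<zeta> ^ m * complex_of_real (f \<zeta>))" for m
    by (intro integrable_mult_circle_measure integrable_of_real f continuous_intros) measurable
  have int0: "integrable circle_measure (\<lambda>\<zeta>. complex_of_real (f \<zeta>))"
    by (intro integrable_of_real f)
  show ?thesis
  proof (rule that)
    show "H holomorphic_on UNIV"
      unfolding H_def[abs_def] divide_inverse by (intro holomorphic_intros)
    fix z :: complex assume z: "norm z = 1"
    define \<kappa> where "\<kappa> u = (of_nat n + 2 * (\<Sum>j<n. \<Sum>k<j. u ^ (j - k))) / of_nat n" for u :: complex
    have K: "\<kappa> (cnj \<zeta> * z) * complex_of_real (f \<zeta>)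
        = (of_nat n * complex_of_real (f \<zeta>) + 2 * (\<Sum>j<n. \<Sum>k<j. (cnj \<zeta> ^ (j - k) * complex_of_real (f \<zeta>)) * z ^ (j - k))) / of_nat n" for \<zeta>
      unfolding \<kappa>_def times_divide_eq_left distrib_right sum_distrib_right sum_distrib_left
        power_mult_distrib by (simp only: mult_ac)
    have intK: "integrable circle_measure (\<lambda>\<zeta>. \<kappa> (cnj \<zeta> * z) * complex_of_real (f \<zeta>))"
      unfolding K
      by (intro integrable_divide Bochner_Integration.integrable_add integrable_mult_right
          Bochner_Integration.integrable_sum integrable_mult_left int int0)
    have "H z = (LINT \<zeta>|circle_measure. \<kappa> (cnj \<zeta> * z) * complex_of_real (f \<zeta>))"
    proof -
      have S: "(LINT \<zeta>|circle_measure. (\<Sum>j<n. \<Sum>k<j. (cnj \<zeta> ^ (j - k) * complex_of_real (f \<zeta>)) * z ^ (j - k)))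
          = (\<Sum>j<n. \<Sum>k<j. c (j - k) * z ^ (j - k))"
        unfolding c_def
        by (subst Bochner_Integration.integral_sum,
            intro Bochner_Integration.integrable_sum integrable_mult_left int,
            intro sum.cong refl,
            subst Bochner_Integration.integral_sum,
            intro integrable_mult_left int,
            intro sum.cong refl integral_mult_left_zero)
      show ?thesis
        unfolding K integral_divide_zero
        by (subst Bochner_Integration.integral_add,
            intro integrable_mult_right int0,
            intro integrable_mult_right Bochner_Integration.integrable_sum integrable_mult_left int)
          (simp add: S H_def c_def)
    qed
    then have "Re (H z) = (LINT \<zeta>|circle_measure. Re (\<kappa> (cnj \<zeta> * z) * complex_of_real (f \<zeta>)))"
      by (simp only: integral_Re[OF intK])
    also have "\<dots> = fejer_mean n f z"
      unfolding fejer_mean_def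
    proof (rule integral_cong_AE)
      show "AE \<zeta> in circle_measure. Re (\<kappa> (cnj \<zeta> * z) * complex_of_real (f \<zeta>)) = fejer n (cnj \<zeta> * z) * f \<zeta>"
        using AE_circle_norm
        by eventually_elim (use z in \<open>simp add: \<kappa>_def fejer_eq_Re norm_mult\<close>)
      show "(\<lambda>\<zeta>. Re (\<kappa> (cnj \<zeta> * z) * complex_of_real (f \<zeta>))) \<in> borel_measurable circle_measure"
        using borel_measurable_integrable[OF intK] by measurable
    qed measurable
    finally show "Re (H z) = fejer_mean n f z" .
  qed
qed

text \<open>Jensen's inequality for the probability density \<open>k\<close>, obtained by
  integrating the tangent line of the exponential at the mean \<open>y\<close>.\<close>

lemma exp_integral_ln_le:
  fixes k w :: "complex \<Rightarrow> real"
  assumes k: "k \<in> borel_measurable borel" "continuous_on (sphere 0 1) k"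
    and pos: "\<And>z. norm z = 1 \<Longrightarrow> 0 \<le> k z" and one: "(LINT z|circle_measure. k z) = 1"
    and w: "integrable circle_measure w" "AE z in circle_measure. w z > 0"
    and lnw: "integrable circle_measure (\<lambda>z. ln (w z))"
  shows "exp (LINT z|circle_measure. k z * ln (w z)) \<le> (LINT z|circle_measure. k z * w z)"
proof -
  define y where "y = (LINT z|circle_measure. k z * ln (w z))"
  have ik: "integrable circle_measure k"
    by (rule integrable_circle_measure[OF k])
  have ikl: "integrable circle_measure (\<lambda>z. k z * ln (w z))"
    by (rule integrable_mult_circle_measure[OF k lnw])
  have ikw: "integrable circle_measure (\<lambda>z. k z * w z)"
    by (rule integrable_mult_circle_measure[OF k w(1)])
  have "exp y = (LINT z|circle_measure. exp y * ((1 - y) * k z + k z * ln (w z)))"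
    using ik ikl one by (simp add: y_def)
  also have "\<dots> \<le> (LINT z|circle_measure. k z * w z)"
  proof (rule integral_mono_AE)
    show "AE z in circle_measure. exp y * ((1 - y) * k z + k z * ln (w z)) \<le> k z * w z"
      using AE_circle_norm w(2)
    proof eventually_elim
      case (elim z)
      have "exp y * (1 + (ln (w z) - y)) \<le> exp y * exp (ln (w z) - y)"
        by (intro mult_left_mono exp_ge_add_one_self) simp
      also have "\<dots> = w z"
        using elim by (simp add: exp_diff)
      finally have "k z * (exp y * (1 + (ln (w z) - y))) \<le> k z * w z"
        using pos[of z] elim by (intro mult_left_mono) auto
      then show ?case
        by (simp add: algebra_simps)
    qed
  qed (use ik ikl ikw in auto)
  finally show ?thesis
    by (simp add: y_def)
qed

lemma fejer_cnj_swap: "fejer n (cnj \<zeta> * z) = fejer n (cnj z * \<zeta>)"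
proof -
  have "(\<Sum>j<n. (cnj z * \<zeta>) ^ j) = cnj (\<Sum>j<n. (cnj \<zeta> * z) ^ j)"
    by (simp add: mult.commute)
  then show ?thesis
    by (simp only: fejer_def complex_mod_cnj)
qed

text \<open>Makes the convergence theorem for Lebesgue points available for a continuous function at
  every point of the circle.\<close>

lemma continuous_Lebesgue_point:
  fixes h :: "complex \<Rightarrow> real"
  assumes h: "h \<in> borel_measurable borel" "continuous_on (sphere 0 1) h" and x: "norm x = 1"
  shows "((\<lambda>\<epsilon>. 1 / measure circle_measure (ball x \<epsilon>) *
            (LINT z:ball x \<epsilon>|circle_measure. \<bar>h z - h x\<bar>)) \<longlongrightarrow> 0) (at_right 0)"
proof (rule tendstoI)
  fix e :: real assume e: "0 < e"
  obtain d where d: "d > 0" "\<And>z. norm z = 1 \<Longrightarrow> dist z x < d \<Longrightarrow> dist (h z) (h x) < e / 2"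
    using h(2)[unfolded continuous_on_iff, rule_format, of x "e / 2"] x e by auto
  have "eventually (\<lambda>\<epsilon>. 0 < \<epsilon> \<and> \<epsilon> < d) (at_right 0)"
    using d(1) by (auto simp: eventually_at_right_field)
  then show "eventually (\<lambda>\<epsilon>. dist (1 / measure circle_measure (ball x \<epsilon>) *
            (LINT z:ball x \<epsilon>|circle_measure. \<bar>h z - h x\<bar>)) 0 < e) (at_right 0)"
  proof eventually_elim
    case (elim \<epsilon>)
    define m where "m = measure circle_measure (ball x \<epsilon>)"
    have m: "m > 0"
      unfolding m_def using measure_circle_ball_pos[OF x] elim by simp
    define I where "I = (LINT z:ball x \<epsilon>|circle_measure. \<bar>h z - h x\<bar>)"
    have I0: "0 \<le> I"
      unfolding I_def set_lebesgue_integral_def by simp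
    have "I \<le> (LINT z|circle_measure. e / 2 * indicator (ball x \<epsilon>) z)"
      unfolding I_def set_lebesgue_integral_def
    proof (rule integral_mono_AE)
      show "integrable circle_measure (\<lambda>z. indicator (ball x \<epsilon>) z *\<^sub>R \<bar>h z - h x\<bar>)"
        by (intro integrable_mult_indicator integrable_abs Bochner_Integration.integrable_diff
            integrable_circle_measure h) auto
      show "AE z in circle_measure. indicator (ball x \<epsilon>) z *\<^sub>R \<bar>h z - h x\<bar> \<le> e / 2 * indicator (ball x \<epsilon>) z"
        using AE_circle_norm
      proof eventually_elim
        case (elim z)
        show ?case
          using d(2)[of z] elim \<open>0 < \<epsilon> \<and> \<epsilon> < d\<close>
          by (auto simp: indicator_def dist_real_def dist_commute less_imp_le)
      qed
    qed (auto simp: circle.emeasure_eq_measure)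
    also have "\<dots> = e / 2 * m"
      by (simp add: m_def)
    finally have "I / m \<le> e / 2"
      using m by (simp add: field_simps)
    then have "I / m < e"
      using e by linarith
    then show ?case
      using I0 m unfolding m_def[symmetric] I_def[symmetric] by (simp add: dist_real_def)
  qed
qed

interpretation circle_pair: pair_sigma_finite circle_measure circle_measure
  by unfold_locales

text \<open>Fubini shifts the averaging from \<open>f\<close>, which is merely integrable, to
  \<open>h\<close>, which is continuous.\<close>

lemma integral_mult_fejer_mean:
  fixes f h :: "complex \<Rightarrow> real"
  assumes h: "h \<in> borel_measurable borel" "continuous_on (sphere 0 1) h"
    and f: "integrable circle_measure f"
  shows "(LINT z|circle_measure. h z * fejer_mean n f z)
       = (LINT \<zeta>|circle_measure. f \<zeta> * (LINT z|circle_measure. fejer n (cnj \<zeta> * z) * h z))"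
proof -
  have [measurable]: "h \<in> borel_measurable borel" "f \<in> borel_measurable borel"
    using h borel_measurable_integrable[OF f] by auto
  obtain B where B: "0 \<le> B" "\<And>z. norm z = 1 \<Longrightarrow> norm (h z) \<le> B"
    using bounded_on_circle[OF h(2)] by auto
  define F where "F = (\<lambda>(\<zeta>, z). fejer n (cnj \<zeta> * z) * h z * f \<zeta>)"
  have Fm [measurable]: "F \<in> borel_measurable (circle_measure \<Otimes>\<^sub>M circle_measure)"
    unfolding F_def by measurable
  have bd: "norm (F (\<zeta>, z)) \<le> real n * B * \<bar>f \<zeta>\<bar>" if "norm \<zeta> = 1" "norm z = 1" for \<zeta> z
  proof -
    have "\<bar>fejer n (cnj \<zeta> * z)\<bar> * \<bar>h z\<bar> \<le> real n * B"
      using fejer_le[of "cnj \<zeta> * z" n] B that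
      by (intro mult_mono) (auto simp: norm_mult fejer_nonneg)
    then show ?thesis
      by (simp add: F_def abs_mult mult_right_mono)
  qed
  have slice: "integrable circle_measure (\<lambda>z. F (\<zeta>, z))" for \<zeta>
    unfolding F_def prod.case
    by (intro integrable_mult_left integrable_circle_measure continuous_intros h) measurable
  have "integrable (circle_measure \<Otimes>\<^sub>M circle_measure) F"
  proof (rule circle_pair.Fubini_integrable[OF Fm])
    show "integrable circle_measure (\<lambda>\<zeta>. LINT z|circle_measure. norm (F (\<zeta>, z)))"
    proof (rule Bochner_Integration.integrable_bound)
      show "integrable circle_measure (\<lambda>\<zeta>. real n * B * \<bar>f \<zeta>\<bar>)"
        using f by simp
      show "AE \<zeta> in circle_measure. norm (LINT z|circle_measure. norm (F (\<zeta>, z))) \<le> norm (real n * B * \<bar>f \<zeta>\<bar>)"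
        using AE_circle_norm
      proof eventually_elim
        case (elim \<zeta>)
        have "(LINT z|circle_measure. norm (F (\<zeta>, z))) \<le> (LINT z|circle_measure. real n * B * \<bar>f \<zeta>\<bar>)"
        proof (rule integral_mono_AE)
          show "AE z in circle_measure. norm (F (\<zeta>, z)) \<le> real n * B * \<bar>f \<zeta>\<bar>"
            using AE_circle_norm by eventually_elim (rule bd[OF elim])
        qed (use slice in auto)
        then show ?case
          using B by simp
      qed
    qed measurable
  qed (use slice in auto)
  then have "(LINT z|circle_measure. (LINT \<zeta>|circle_measure. F (\<zeta>, z)))
      = (LINT \<zeta>|circle_measure. (LINT z|circle_measure. F (\<zeta>, z)))"
    by (intro circle_pair.Fubini_integral) (simp add: split_beta')
  moreover have "(LINT \<zeta>|circle_measure. F (\<zeta>, z)) = h z * fejer_mean n f z" for z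
  proof -
    have "F (\<zeta>, z) = h z * (fejer n (cnj \<zeta> * z) * f \<zeta>)" for \<zeta>
      by (simp add: F_def)
    then show ?thesis
      by (simp only: fejer_mean_def integral_mult_right_zero)
  qed
  moreover have "(LINT z|circle_measure. F (\<zeta>, z)) = f \<zeta> * (LINT z|circle_measure. fejer n (cnj \<zeta> * z) * h z)" for \<zeta>
    unfolding F_def prod.case integral_mult_left_zero by (rule mult.commute)
  ultimately show ?thesis
    by simp
qed

text \<open>With the averaging shifted to \<open>h\<close>, the means converge at every point of the
  circle and stay below \<open>B\<close>, so B |f| is a majorant. Later \<open>h\<close> is a
  squared polynomial or a Poisson kernel.\<close>

lemma integral_mult_fejer_mean_tendsto:
  fixes f h :: "complex \<Rightarrow> real"
  assumes h: "h \<in> borel_measurable borel" "continuous_on (sphere 0 1) h"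
    and f: "integrable circle_measure f"
  shows "(\<lambda>n. LINT z|circle_measure. h z * fejer_mean n f z) \<longlonglongrightarrow> (LINT z|circle_measure. h z * f z)"
proof -
  have [measurable]: "h \<in> borel_measurable borel" "f \<in> borel_measurable borel"
    using h borel_measurable_integrable[OF f] by auto
  obtain B where B: "0 \<le> B" "\<And>z. norm z = 1 \<Longrightarrow> norm (h z) \<le> B"
    using bounded_on_circle[OF h(2)] by auto
  have "(\<lambda>n. LINT \<zeta>|circle_measure. f \<zeta> * (LINT z|circle_measure. fejer n (cnj \<zeta> * z) * h z))
      \<longlonglongrightarrow> (LINT \<zeta>|circle_measure. f \<zeta> * h \<zeta>)"
  proof (rule integral_dominated_convergence)
    show "integrable circle_measure (\<lambda>\<zeta>. B * \<bar>f \<zeta>\<bar>)"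
      using f by simp
    show "AE \<zeta> in circle_measure. (\<lambda>n. f \<zeta> * (LINT z|circle_measure. fejer n (cnj \<zeta> * z) * h z)) \<longlonglongrightarrow> f \<zeta> * h \<zeta>"
      using AE_circle_norm
    proof eventually_elim
      case (elim \<zeta>)
      show ?case
        by (intro tendsto_mult tendsto_const peak_kernel_Lebesgue_point[OF elim]
            integrable_circle_measure h continuous_Lebesgue_point elim peak_kernel_fejer integral_fejer)
    qed
    fix n
    show "AE \<zeta> in circle_measure. norm (f \<zeta> * (LINT z|circle_measure. fejer n (cnj \<zeta> * z) * h z)) \<le> B * \<bar>f \<zeta>\<bar>"
      using AE_circle_norm
    proof eventually_elim
      case (elim \<zeta>)
      have "norm (LINT z|circle_measure. fejer n (cnj \<zeta> * z) * h z) \<le> (LINT z|circle_measure. norm (fejer n (cnj \<zeta> * z) * h z))"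
        by (rule integral_norm_bound)
      also have "\<dots> \<le> (LINT z|circle_measure. B * fejer n (cnj \<zeta> * z))"
      proof (rule integral_mono_AE)
        show "AE z in circle_measure. norm (fejer n (cnj \<zeta> * z) * h z) \<le> B * fejer n (cnj \<zeta> * z)"
          using AE_circle_norm
          by eventually_elim (use B in \<open>auto simp: abs_mult fejer_nonneg mult.commute intro!: mult_right_mono\<close>)
      qed (intro integrable_norm integrable_circle_measure continuous_intros h; measurable)+
      \<comment> \<open>For \<open>n = 0\<close> the kernel is zero by the division convention, not
        of mass one.\<close>
      also have "\<dots> \<le> B"
        using integral_fejer[OF elim, of n] B by (cases "n = 0") (auto simp: fejer_def)
      finally have "\<bar>f \<zeta>\<bar> * norm (LINT z|circle_measure. fejer n (cnj \<zeta> * z) * h z) \<le> \<bar>f \<zeta>\<bar> * B"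
        by (intro mult_left_mono) auto
      then show ?case
        unfolding norm_mult by (simp only: real_norm_def mult.commute)
    qed
  qed measurable
  then show ?thesis
    by (simp add: integral_mult_fejer_mean[OF h f] mult.commute)
qed

lemma borel_measurable_fejer_mean:
  assumes f: "f \<in> borel_measurable borel"
  shows "fejer_mean n f \<in> borel_measurable borel"
proof -
  note f [measurable]
  have "(\<lambda>z. LINT \<zeta>|circle_measure. fejer n (cnj \<zeta> * z) * f \<zeta>) \<in> borel_measurable borel"
    by (rule circle.borel_measurable_lebesgue_integral) measurable
  then show ?thesis
    by (simp add: fejer_mean_def[abs_def])
qed

text \<open>On the circle the Fejer mean is the real part of an entire function, hence continuous
  there.\<close>

lemma integrable_mult_fejer_mean:
  fixes f h :: "complex \<Rightarrow> real"
  assumes h: "h \<in> borel_measurable borel" "continuous_on (sphere 0 1) h"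
    and f: "integrable circle_measure f"
  shows "integrable circle_measure (\<lambda>z. h z * fejer_mean n f z)"
proof -
  obtain H where H: "H holomorphic_on UNIV" "\<And>z. norm z = 1 \<Longrightarrow> Re (H z) = fejer_mean n f z"
    using fejer_mean_eq_Re_entire[OF f] by blast
  have contH: "continuous_on A H" for A
    using H(1) by (meson continuous_on_subset holomorphic_on_imp_continuous_on subset_UNIV)
  have [measurable]: "H \<in> borel_measurable borel"
    using contH by (rule borel_measurable_continuous_onI)
  have [measurable]: "h \<in> borel_measurable borel" "fejer_mean n f \<in> borel_measurable borel"
    using h borel_measurable_integrable[OF f] by (auto intro: borel_measurable_fejer_mean)
  have "integrable circle_measure (\<lambda>z. h z * Re (H z))"
    by (intro integrable_circle_measure continuous_intros h contH) measurable
  moreover have "AE z in circle_measure. h z * Re (H z) = h z * fejer_mean n f z"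
    using AE_circle_norm by eventually_elim (simp add: H(2))
  ultimately show ?thesis
    by (elim integrable_cong_AE_imp) measurable
qed

text \<open>The entire case is used for |D|^2 = exp (Re H), with \<open>Re H\<close> the Fejer mean
  of \<open>ln w\<close>. The value at \<open>a\<close> is then the exponential of a Poisson
  average, and on the circle |D|^2 lies below the Fejer mean of \<open>w\<close>. So both integrals
  of |D|^2 may be replaced by integrals of Fejer means, and every term has a limit.\<close>

lemma christoffel_bound:
  fixes w :: "complex \<Rightarrow> real" and P :: "complex poly"
  assumes w: "integrable circle_measure w" "AE z in circle_measure. w z > 0"
    and lnw: "integrable circle_measure (\<lambda>z. ln (w z))"
    and P: "degree P < n" and a: "norm a < 1"
  defines "A \<equiv> (LINT z|circle_measure. poisson a z * w z)"
    and "G \<equiv> (LINT z|circle_measure. poisson a z * ln (w z))"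
  shows "norm (poly P a) * exp (G / 2)
    \<le> sqrt (LINT z|circle_measure. (norm (poly P z))\<^sup>2 * w z) *
      (sqrt (\<Sum>j<n. norm a ^ (2 * j)) + 4 * sqrt ((A / exp G - 1) / (1 - (norm a)\<^sup>2)))"
proof -
  have [measurable]: "poly P \<in> borel_measurable borel"
    by (intro borel_measurable_continuous_onI continuous_intros)
  have [measurable]: "w \<in> borel_measurable borel"
    using borel_measurable_integrable[OF w(1)] by simp
  have Pk: "(\<lambda>z. (norm (poly P z))\<^sup>2) \<in> borel_measurable borel"
      "continuous_on (sphere 0 1) (\<lambda>z. (norm (poly P z))\<^sup>2)"
    by (measurable, intro continuous_intros)
  note ak = borel_measurable_poisson[of a] continuous_on_poisson[OF a]
  have [measurable]: "fejer_mean N w \<in> borel_measurable borel"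
      "fejer_mean N (\<lambda>z. ln (w z)) \<in> borel_measurable borel" for N
    by (intro borel_measurable_fejer_mean; measurable)+
  have a2: "0 \<le> 1 - (norm a)\<^sup>2"
    using a by (simp add: power_le_one)
  define X where "X N = (LINT z|circle_measure. (norm (poly P z))\<^sup>2 * fejer_mean N w z)" for N
  define A' where "A' N = (LINT z|circle_measure. poisson a z * fejer_mean N w z)" for N
  define G' where "G' N = (LINT z|circle_measure. poisson a z * fejer_mean N (\<lambda>z. ln (w z)) z)" for N
  have X: "X \<longlonglongrightarrow> (LINT z|circle_measure. (norm (poly P z))\<^sup>2 * w z)"
    unfolding X_def by (rule integral_mult_fejer_mean_tendsto[OF Pk w(1)])
  have A': "A' \<longlonglongrightarrow> A"
    unfolding A'_def A_def by (rule integral_mult_fejer_mean_tendsto[OF ak w(1)])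
  have G': "G' \<longlonglongrightarrow> G"
    unfolding G'_def G_def by (rule integral_mult_fejer_mean_tendsto[OF ak lnw])
  \<comment> \<open>\<open>N > 0\<close> gives the Fejer kernel mass one, as Jensen's inequality
    requires.\<close>
  have approx: "norm (poly P a) * exp (G' N / 2) \<le> sqrt (X N) *
      (sqrt (\<Sum>j<n. norm a ^ (2 * j)) + 4 * sqrt ((A' N / exp (G' N) - 1) / (1 - (norm a)\<^sup>2)))"
    if N: "N > 0" for N
  proof -
    obtain H where H: "H holomorphic_on UNIV"
      "\<And>z. norm z = 1 \<Longrightarrow> Re (H z) = fejer_mean N (\<lambda>z. ln (w z)) z"
      using fejer_mean_eq_Re_entire[OF lnw] by blast
    have contH: "continuous_on A H" for A
      using H(1) by (meson continuous_on_subset holomorphic_on_imp_continuous_on subset_UNIV)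
    have [measurable]: "H \<in> borel_measurable borel"
      using contH by (rule borel_measurable_continuous_onI)
    define D where "D z = exp (H z / 2)" for z
    have D: "D holomorphic_on UNIV" "\<And>z. D z \<noteq> 0"
      unfolding D_def[abs_def] by (intro holomorphic_intros H) simp_all
    have D2: "(norm (D z))\<^sup>2 = exp (Re (H z))" for z
      by (simp add: D_def power2_eq_square exp_add[symmetric])
    have [measurable]: "D \<in> borel_measurable borel"
      unfolding D_def[abs_def] by measurable
    have contD: "continuous_on A D" for A
      unfolding D_def[abs_def] by (intro continuous_intros contH) auto
    have "(LINT z|circle_measure. poisson a z * Re (H z)) = Re (H a)"
      by (rule integral_poisson_Re[OF contH holomorphic_on_subset[OF H(1)] a]) auto
    moreover have "(LINT z|circle_measure. poisson a z * Re (H z)) = G' N"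
      unfolding G'_def
    proof (rule integral_cong_AE)
      show "AE z in circle_measure. poisson a z * Re (H z) = poisson a z * fejer_mean N (\<lambda>z. ln (w z)) z"
        using AE_circle_norm by eventually_elim (simp add: H(2))
    qed measurable
    ultimately have Ha: "Re (H a) = G' N"
      by simp
    have nD: "norm (D a) = exp (G' N / 2)"
      by (simp add: D_def Ha)
    have Dle: "(norm (D z))\<^sup>2 \<le> fejer_mean N w z" if z: "norm z = 1" for z
    proof -
      have "exp (LINT \<zeta>|circle_measure. fejer N (cnj \<zeta> * z) * ln (w \<zeta>))
          \<le> (LINT \<zeta>|circle_measure. fejer N (cnj \<zeta> * z) * w \<zeta>)"
      proof (rule exp_integral_ln_le[OF _ _ _ _ w lnw])
        show "(LINT \<zeta>|circle_measure. fejer N (cnj \<zeta> * z)) = 1"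
          by (subst fejer_cnj_swap) (rule integral_fejer[OF z N])
      qed (auto intro!: continuous_intros fejer_nonneg)
      then show ?thesis
        unfolding D2 H(2)[OF z] by (simp add: fejer_mean_def)
    qed
    have mono: "(LINT z|circle_measure. k z * (norm (D z))\<^sup>2) \<le> (LINT z|circle_measure. k z * fejer_mean N w z)"
      if k: "k \<in> borel_measurable borel" "continuous_on (sphere 0 1) k" and k0: "\<And>z. 0 \<le> k z"
      for k :: "complex \<Rightarrow> real"
    proof (rule integral_mono_AE)
      note k(1)[measurable]
      show "integrable circle_measure (\<lambda>z. k z * (norm (D z))\<^sup>2)"
        by (intro integrable_circle_measure continuous_intros k contD) measurable
      show "integrable circle_measure (\<lambda>z. k z * fejer_mean N w z)"
        by (rule integrable_mult_fejer_mean[OF k w(1)])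
      show "AE z in circle_measure. k z * (norm (D z))\<^sup>2 \<le> k z * fejer_mean N w z"
        using AE_circle_norm by eventually_elim (intro mult_left_mono Dle k0)
    qed
    have "norm (poly P a) * exp (G' N / 2)
      \<le> sqrt (LINT z|circle_measure. (norm (poly P z))\<^sup>2 * (norm (D z))\<^sup>2) *
      (sqrt (\<Sum>j<n. norm a ^ (2 * j)) +
       4 * sqrt (((LINT z|circle_measure. poisson a z * (norm (D z))\<^sup>2) / (norm (D a))\<^sup>2 - 1)
                 / (1 - (norm a)\<^sup>2)))"
      using christoffel_bound_entire[OF D P a] by (simp only: nD)
    also have "\<dots> \<le> sqrt (X N) *
      (sqrt (\<Sum>j<n. norm a ^ (2 * j)) + 4 * sqrt ((A' N / exp (G' N) - 1) / (1 - (norm a)\<^sup>2)))"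
    proof (rule mult_mono)
      show "sqrt (LINT z|circle_measure. (norm (poly P z))\<^sup>2 * (norm (D z))\<^sup>2) \<le> sqrt (X N)"
        unfolding X_def by (intro real_sqrt_le_mono mono Pk) auto
      have Da2: "(norm (D a))\<^sup>2 = exp (G' N)"
        by (simp add: D2 Ha)
      have "(LINT z|circle_measure. poisson a z * (norm (D z))\<^sup>2) \<le> A' N"
        unfolding A'_def by (intro mono ak poisson_nonneg a)
      then show "sqrt (\<Sum>j<n. norm a ^ (2 * j)) +
          4 * sqrt (((LINT z|circle_measure. poisson a z * (norm (D z))\<^sup>2) / (norm (D a))\<^sup>2 - 1)
                 / (1 - (norm a)\<^sup>2))
          \<le> sqrt (\<Sum>j<n. norm a ^ (2 * j)) + 4 * sqrt ((A' N / exp (G' N) - 1) / (1 - (norm a)\<^sup>2))"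
        unfolding Da2 using a2
        by (intro add_mono mult_left_mono real_sqrt_le_mono divide_right_mono diff_mono) auto
      show "0 \<le> sqrt (X N)"
        unfolding X_def
      proof (intro real_sqrt_ge_zero integral_nonneg_AE)
        show "AE z in circle_measure. 0 \<le> (norm (poly P z))\<^sup>2 * fejer_mean N w z"
          using AE_circle_norm
        proof eventually_elim
          case (elim z)
          have "0 \<le> fejer_mean N w z"
            using Dle[OF elim] by (rule order_trans[rotated]) simp
          then show ?case
            by simp
        qed
      qed
      \<comment> \<open>Jensen's inequality for the Poisson kernel makes the radicand nonnegative, a
        side condition of multiplying the two estimates.\<close>
      have "1 \<le> (LINT z|circle_measure. poisson a z * (norm (D z))\<^sup>2) / (norm (D a))\<^sup>2"
      proof -
        have "exp (LINT z|circle_measure. poisson a z * ln ((norm (D z))\<^sup>2))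
            \<le> (LINT z|circle_measure. poisson a z * (norm (D z))\<^sup>2)"
        proof (rule exp_integral_ln_le[OF ak poisson_nonneg[OF a] integral_poisson[OF a]])
          show "integrable circle_measure (\<lambda>z. (norm (D z))\<^sup>2)"
            by (intro integrable_circle_measure continuous_intros contD) measurable
          show "integrable circle_measure (\<lambda>z. ln ((norm (D z))\<^sup>2))"
            unfolding D2 ln_exp by (intro integrable_circle_measure continuous_intros contH) measurable
        qed (use D in auto)
        then show ?thesis
          using \<open>(LINT z|circle_measure. poisson a z * Re (H z)) = G' N\<close> \<open>(norm (D a))\<^sup>2 = exp (G' N)\<close>
          by (simp add: D2)
      qed
      then show "0 \<le> sqrt (\<Sum>j<n. norm a ^ (2 * j)) +
       4 * sqrt (((LINT z|circle_measure. poisson a z * (norm (D z))\<^sup>2) / (norm (D a))\<^sup>2 - 1)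
                 / (1 - (norm a)\<^sup>2))"
        using a2 by (intro add_nonneg_nonneg mult_nonneg_nonneg real_sqrt_ge_zero sum_nonneg divide_nonneg_nonneg) auto
    qed
    finally show ?thesis .
  qed
  show ?thesis
  proof (rule LIMSEQ_le)
    show "(\<lambda>N. norm (poly P a) * exp (G' N / 2)) \<longlonglongrightarrow> norm (poly P a) * exp (G / 2)"
      by (intro tendsto_intros G') simp
    show "(\<lambda>N. sqrt (X N) * (sqrt (\<Sum>j<n. norm a ^ (2 * j)) +
        4 * sqrt ((A' N / exp (G' N) - 1) / (1 - (norm a)\<^sup>2))))
      \<longlonglongrightarrow> sqrt (LINT z|circle_measure. (norm (poly P z))\<^sup>2 * w z) *
      (sqrt (\<Sum>j<n. norm a ^ (2 * j)) + 4 * sqrt ((A / exp G - 1) / (1 - (norm a)\<^sup>2)))"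
      unfolding divide_inverse by (intro tendsto_intros X A' G') auto
    show "\<exists>N0. \<forall>N\<ge>N0. norm (poly P a) * exp (G' N / 2) \<le> sqrt (X N) *
      (sqrt (\<Sum>j<n. norm a ^ (2 * j)) + 4 * sqrt ((A' N / exp (G' N) - 1) / (1 - (norm a)\<^sup>2)))"
      using approx by (intro exI[of _ 1]) auto
  qed
qed

section \<open>Reflecting zeros\<close>

text \<open>With y = r x, the vector (1 + r)(x - c) is the sum of y - c and x times the conjugate of
  1 - cnj c y, so the longer summand has at least half its length. Which one is longer is decided by
  the sign of (1 - |y|^2)(1 - |c|^2), the difference of the squared moduli.\<close>

lemma reflect_zeros_factor:
  fixes c x :: complex
  assumes x: "norm x = 1" and r: "0 \<le> r" "r \<le> 1"
  defines "M \<equiv> max (norm (of_real r * x - c)) (norm (1 - cnj c * (of_real r * x)))"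
  shows "(1 + r) / 2 * norm (x - c) \<le> M"
    and "norm c \<ge> 1 \<Longrightarrow> M = norm (of_real r * x - c)"
    and "norm c < 1 \<Longrightarrow> M = norm (1 - cnj c * (of_real r * x))"
proof -
  define y where "y = of_real r * x"
  have xc: "x * cnj x = 1" "cnj x * x = 1"
    using cnj_mult_self_of_norm_1[OF x] by auto
  have ny: "norm y = r"
    using x r by (simp add: y_def norm_mult)
  have "of_real (1 + r) * (x - c) = (y - c) + x * cnj (1 - cnj c * y)"
  proof -
    have "x * cnj (1 - cnj c * y) = x - of_real r * (x * cnj x) * c"
      by (simp add: y_def algebra_simps)
    then show ?thesis
      by (simp add: xc y_def algebra_simps)
  qed
  then have "norm (of_real (1 + r) * (x - c)) \<le> norm (y - c) + norm (x * cnj (1 - cnj c * y))"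
    by (metis norm_triangle_ineq)
  moreover have "norm (x * cnj (1 - cnj c * y)) = norm (1 - cnj c * y)"
    unfolding norm_mult complex_mod_cnj using x by simp
  moreover have "norm (of_real (1 + r) * (x - c)) = (1 + r) * norm (x - c)"
    unfolding norm_mult norm_of_real using r by simp
  ultimately show "(1 + r) / 2 * norm (x - c) \<le> M"
    unfolding M_def y_def by simp
  have id: "(norm (1 - cnj c * y))\<^sup>2 - (norm (y - c))\<^sup>2 = (1 - (norm y)\<^sup>2) * (1 - (norm c)\<^sup>2)"
    by (simp only: cmod_power2) (simp add: power2_eq_square algebra_simps)
  have y1: "0 \<le> 1 - (norm y)\<^sup>2"
    using ny r by (simp add: power_le_one)
  show "M = norm (of_real r * x - c)" if "norm c \<ge> 1"
  proof -
    have "1 \<le> (norm c)\<^sup>2"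
      using that by simp
    then have "(1 - (norm y)\<^sup>2) * (1 - (norm c)\<^sup>2) \<le> 0"
      by (intro mult_nonneg_nonpos y1) simp
    then have "(norm (1 - cnj c * y))\<^sup>2 \<le> (norm (y - c))\<^sup>2"
      using id by linarith
    then have "norm (1 - cnj c * y) \<le> norm (y - c)"
      by (rule power2_le_imp_le) simp
    then show ?thesis
      unfolding M_def y_def by simp
  qed
  show "M = norm (1 - cnj c * (of_real r * x))" if "norm c < 1"
  proof -
    have "(norm c)\<^sup>2 \<le> 1"
      using that by (simp add: power_le_one)
    then have "0 \<le> (1 - (norm y)\<^sup>2) * (1 - (norm c)\<^sup>2)"
      by (intro mult_nonneg_nonneg y1) simp
    then have "(norm (y - c))\<^sup>2 \<le> (norm (1 - cnj c * y))\<^sup>2"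
      using id by linarith
    then have "norm (y - c) \<le> norm (1 - cnj c * y)"
      by (rule power2_le_imp_le) simp
    then show ?thesis
      unfolding M_def y_def by simp
  qed
qed

text \<open>
  Replacing each zero \<open>c\<close> inside the disc by \<open>1 / cnj c\<close> does not change the modulus on the
  circle, and a polynomial without zeros in the disc decays only slowly along a radius.
\<close>

lemma reflect_zeros:
  fixes p :: "complex poly"
  obtains q where "degree q \<le> degree p" "\<And>z. norm z = 1 \<Longrightarrow> norm (poly q z) = norm (poly p z)"
    "\<And>x r. norm x = 1 \<Longrightarrow> 0 \<le> r \<Longrightarrow> r \<le> 1 \<Longrightarrow>
       ((1 + r) / 2) ^ degree p * norm (poly p x) \<le> norm (poly q (of_real r * x))"
proof -
  have "\<exists>q. degree q \<le> degree p \<and> (\<forall>z. norm z = 1 \<longrightarrow> norm (poly q z) = norm (poly p z)) \<and>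
    (\<forall>x r. norm x = 1 \<longrightarrow> 0 \<le> r \<longrightarrow> r \<le> 1 \<longrightarrow>
       ((1 + r) / 2) ^ degree p * norm (poly p x) \<le> norm (poly q (of_real r * x)))"
  proof (induction "degree p" arbitrary: p)
    case 0
    then obtain c where "p = [:c:]"
      by (metis degree_eq_zeroE)
    then show ?case
      by (intro exI[of _ p]) auto
  next
    case (Suc n)
    have "\<exists>z. poly p z = 0"
      by (rule fundamental_theorem_of_algebra) (use Suc(2) in \<open>simp add: constant_degree\<close>)
    then obtain c s where p: "p = [:- c, 1:] * s"
      by (metis dvdE poly_eq_0_iff_dvd)
    have "p \<noteq> 0"
      using Suc(2) by auto
    then have "s \<noteq> 0"
      using p by auto
    then have deg: "degree p = Suc (degree s)"
      unfolding p by (subst degree_mult_eq) auto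
    with Suc obtain t where t: "degree t \<le> degree s"
        "\<And>z. norm z = 1 \<Longrightarrow> norm (poly t z) = norm (poly s z)"
        "\<And>x r. norm x = 1 \<Longrightarrow> 0 \<le> r \<Longrightarrow> r \<le> 1 \<Longrightarrow>
          ((1 + r) / 2) ^ degree s * norm (poly s x) \<le> norm (poly t (of_real r * x))"
      by (metis Suc_inject)
    have px: "poly p z = (z - c) * poly s z" for z
      by (simp add: p algebra_simps)
    \<comment> \<open>For \<open>c = 0\<close> the reflected factor is the constant 1, so the degree
      may drop, as the statement allows.\<close>
    define l where "l = (if norm c < 1 then [:1, - cnj c:] else [:- c, 1:])"
    have dl: "degree l \<le> 1"
      by (simp add: l_def)
    have l1: "norm (poly l z) = norm (z - c)" if z: "norm z = 1" for z
    proof (cases "norm c < 1")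
      case True
      have "1 - cnj c * z = z * cnj (z - c)"
        using cnj_mult_self_of_norm_1[OF z] by (simp add: right_diff_distrib mult.commute)
      then have "norm (1 - cnj c * z) = norm (z - c)"
        using z by (simp only: norm_mult complex_mod_cnj mult_1_left)
      then show ?thesis
        using True by (simp add: l_def mult.commute)
    qed (simp add: l_def)
    have l2: "(1 + r) / 2 * norm (x - c) \<le> norm (poly l (of_real r * x))"
      if "norm x = 1" "0 \<le> r" "r \<le> 1" for x r
      using reflect_zeros_factor[OF that, of c]
      by (cases "norm c < 1") (simp_all add: l_def mult.commute)
    show ?case
    proof (intro exI[of _ "l * t"] conjI allI impI)
      show "degree (l * t) \<le> degree p"
        using degree_mult_le[of l t] dl t(1) deg by linarith
      show "norm (poly (l * t) z) = norm (poly p z)" if "norm z = 1" for z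
        using that by (simp add: px norm_mult l1 t(2))
      fix x :: complex and r :: real assume xr: "norm x = 1" "0 \<le> r" "r \<le> 1"
      have "((1 + r) / 2) ^ degree p * norm (poly p x)
          = ((1 + r) / 2 * norm (x - c)) * (((1 + r) / 2) ^ degree s * norm (poly s x))"
        unfolding deg px by (simp add: norm_mult mult_ac)
      also have "\<dots> \<le> norm (poly l (of_real r * x)) * norm (poly t (of_real r * x))"
        by (intro mult_mono l2 t(3) xr) (use xr in auto)
      finally show "((1 + r) / 2) ^ degree p * norm (poly p x) \<le> norm (poly (l * t) (of_real r * x))"
        by (simp add: norm_mult)
    qed
  qed
  then show ?thesis
    using that by blast
qed

section \<open>Orthonormal polynomials\<close>

text \<open>Positivity on nonzero polynomials ensures that no Gram-Schmidt residual has norm zero,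
  so the division convention in the recursion never acts.\<close>

locale circle_moment_measure =
  fixes \<mu> :: "complex measure"
  assumes finite_mu: "finite_measure \<mu>" and sets_mu: "sets \<mu> = sets borel"
    and AE_mu: "AE z in \<mu>. norm z = 1"
    and norm_pos: "\<And>p. p \<noteq> 0 \<Longrightarrow> 0 < (LINT z|\<mu>. (cmod (poly p z))\<^sup>2)"
begin

lemma borel_measurable_poly: "poly p \<in> borel_measurable borel" for p :: "complex poly"
  by (intro borel_measurable_continuous_onI continuous_intros)

lemma integrable_poly_mult_cnj: "integrable \<mu> (\<lambda>z. poly p z * cnj (poly q z))"
  using borel_measurable_poly[measurable]
  by (intro integrable_on_circle[OF finite_mu sets_mu AE_mu] continuous_intros) measurable

lemma L2_inner_cnj: "L2_inner \<mu> q p = cnj (L2_inner \<mu> p q)"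
proof -
  have "cnj (L2_inner \<mu> p q) = (LINT z|\<mu>. cnj (poly p z * cnj (poly q z)))"
    unfolding L2_inner_def by (rule Bochner_Integration.integral_cnj[symmetric])
  then show ?thesis
    by (simp add: L2_inner_def mult.commute)
qed

lemma L2_inner_add_left: "L2_inner \<mu> (p + q) s = L2_inner \<mu> p s + L2_inner \<mu> q s"
  using integrable_poly_mult_cnj[of p s] integrable_poly_mult_cnj[of q s]
  by (simp add: L2_inner_def distrib_right)

lemma L2_inner_diff_left: "L2_inner \<mu> (p - q) s = L2_inner \<mu> p s - L2_inner \<mu> q s"
  using integrable_poly_mult_cnj[of p s] integrable_poly_mult_cnj[of q s]
  by (simp add: L2_inner_def left_diff_distrib)

lemma L2_inner_smult_left: "L2_inner \<mu> (smult c p) s = c * L2_inner \<mu> p s"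
  by (simp add: L2_inner_def mult.assoc)

lemma L2_inner_sum_left: "L2_inner \<mu> (\<Sum>k\<in>A. p k) s = (\<Sum>k\<in>A. L2_inner \<mu> (p k) s)"
proof (induction A rule: infinite_finite_induct)
  case (insert k A)
  then show ?case
    by (simp add: L2_inner_add_left)
qed (simp_all add: L2_inner_def)

lemma L2_inner_self: "L2_inner \<mu> p p = complex_of_real (LINT z|\<mu>. (cmod (poly p z))\<^sup>2)"
  unfolding L2_inner_def complex_norm_square[symmetric] by (rule integral_complex_of_real)

definition residual :: "nat \<Rightarrow> complex poly" where
  "residual n = monom 1 n - (\<Sum>k<n. smult (L2_inner \<mu> (monom 1 n) (orthonormal_poly \<mu> k))
                                         (orthonormal_poly \<mu> k))"

lemma orthonormal_poly_eq:
  "orthonormal_poly \<mu> n = smult (complex_of_real (1 / L2_norm \<mu> (residual n))) (residual n)"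
  by (subst orthonormal_poly.simps) (simp add: residual_def Let_def)

lemma degree_orthonormal_poly: "degree (orthonormal_poly \<mu> n) \<le> n"
proof (induction n rule: less_induct)
  case (less n)
  have "degree (residual n) \<le> n"
    unfolding residual_def
    by (intro degree_diff_le degree_monom_le degree_sum_le order_trans[OF degree_smult_le])
      (use less in \<open>auto intro: order_trans[OF _ less_imp_le]\<close>)
  then show ?case
    unfolding orthonormal_poly_eq[of n] by (rule order_trans[OF degree_smult_le])
qed

text \<open>The subtracted polynomials have degree below \<open>n\<close>, so the residual keeps the
  leading coefficient 1.\<close>

lemma L2_norm_residual_pos: "0 < L2_norm \<mu> (residual n)"
proof -
  have "coeff (residual n) n = 1"
  proof -
    have "coeff (orthonormal_poly \<mu> k) n = 0" if "k < n" for k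
      using degree_orthonormal_poly[of k] that by (intro coeff_eq_0) linarith
    then show ?thesis
      by (simp add: residual_def coeff_sum)
  qed
  then have "residual n \<noteq> 0"
    by auto
  then show ?thesis
    by (simp add: L2_norm_def norm_pos)
qed

text \<open>Orthogonality of the index \<open>n\<close> to a smaller one uses the relations among
  all smaller indices, so the induction carries all pairs below \<open>n\<close>.\<close>

lemma L2_inner_orthonormal_poly:
  "L2_inner \<mu> (orthonormal_poly \<mu> j) (orthonormal_poly \<mu> k) = of_bool (j = k)"
proof -
  have "\<forall>j<n. \<forall>k<n. L2_inner \<mu> (orthonormal_poly \<mu> j) (orthonormal_poly \<mu> k) = of_bool (j = k)" for n
  proof (induction n)
    case (Suc n)
    define N where "N = L2_norm \<mu> (residual n)"
    have N: "N > 0" "N\<^sup>2 = (LINT z|\<mu>. (cmod (poly (residual n) z))\<^sup>2)"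
      using L2_norm_residual_pos[of n] by (auto simp: N_def L2_norm_def)
    have orth: "L2_inner \<mu> (orthonormal_poly \<mu> n) (orthonormal_poly \<mu> j) = 0" if j: "j < n" for j
    proof -
      have "(\<Sum>k<n. L2_inner \<mu> (monom 1 n) (orthonormal_poly \<mu> k) *
              L2_inner \<mu> (orthonormal_poly \<mu> k) (orthonormal_poly \<mu> j))
          = (\<Sum>k<n. if k = j then L2_inner \<mu> (monom 1 n) (orthonormal_poly \<mu> k) else 0)"
        using Suc.IH j by (intro sum.cong) auto
      also have "\<dots> = L2_inner \<mu> (monom 1 n) (orthonormal_poly \<mu> j)"
        using j by simp
      finally have "L2_inner \<mu> (residual n) (orthonormal_poly \<mu> j) = 0"
        by (simp add: residual_def L2_inner_diff_left L2_inner_sum_left L2_inner_smult_left)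
      then show ?thesis
        by (simp add: orthonormal_poly_eq[of n] L2_inner_smult_left)
    qed
    have "L2_inner \<mu> (orthonormal_poly \<mu> n) (orthonormal_poly \<mu> n)
        = complex_of_real (LINT z|\<mu>. (cmod (poly (residual n) z))\<^sup>2 / N\<^sup>2)"
      unfolding L2_inner_self orthonormal_poly_eq[of n] N_def[symmetric] using N(1)
      by (simp add: norm_mult norm_divide power_divide power_mult_distrib del: integral_divide_zero)
    also have "\<dots> = 1"
      unfolding integral_divide_zero N(2)[symmetric] using N(1) by simp
    finally have self: "L2_inner \<mu> (orthonormal_poly \<mu> n) (orthonormal_poly \<mu> n) = 1" .
    have orth': "L2_inner \<mu> (orthonormal_poly \<mu> j) (orthonormal_poly \<mu> n) = 0" if j: "j < n" for j
      using L2_inner_cnj[of "orthonormal_poly \<mu> n" "orthonormal_poly \<mu> j"] orth[OF j] by simp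
    show ?case
      using Suc.IH self orth orth' by (auto simp: less_Suc_eq)
  qed simp
  from this[of "Suc (max j k)"] show ?thesis
    by (simp add: less_Suc_eq_le)
qed

lemma Parseval_orthonormal_poly:
  "(LINT z|\<mu>. (cmod (poly (\<Sum>k<n. smult (c k) (orthonormal_poly \<mu> k)) z))\<^sup>2) = (\<Sum>k<n. (cmod (c k))\<^sup>2)"
proof -
  define p where "p = (\<Sum>k<n. smult (c k) (orthonormal_poly \<mu> k))"
  have coef: "L2_inner \<mu> p (orthonormal_poly \<mu> j) = c j" if "j < n" for j
  proof -
    have "L2_inner \<mu> p (orthonormal_poly \<mu> j) = (\<Sum>k<n. if k = j then c k else 0)"
      unfolding p_def L2_inner_sum_left L2_inner_smult_left L2_inner_orthonormal_poly
      by (intro sum.cong) auto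
    then show ?thesis
      using that by simp
  qed
  have "L2_inner \<mu> p p = (\<Sum>k<n. c k * L2_inner \<mu> (orthonormal_poly \<mu> k) p)"
    by (subst (1) p_def) (simp only: L2_inner_sum_left L2_inner_smult_left)
  also have "\<dots> = (\<Sum>k<n. complex_of_real ((cmod (c k))\<^sup>2))"
    by (intro sum.cong) (auto simp: L2_inner_cnj[of _ p] coef complex_norm_square[symmetric] simp del: of_real_power)
  finally have "complex_of_real (LINT z|\<mu>. (cmod (poly p z))\<^sup>2) = complex_of_real (\<Sum>k<n. (cmod (c k))\<^sup>2)"
    by (simp add: L2_inner_self)
  then show ?thesis
    unfolding p_def[symmetric] of_real_eq_iff .
qed

text \<open>The zero polynomial is listed separately because its degree is 0, which is not below
  \<open>n = 0\<close>. The step splits off the leading term, and \<open>monom 1 n\<close> is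
  recovered from the Gram-Schmidt recursion.\<close>

lemma orthonormal_poly_span:
  assumes "p = 0 \<or> degree p < n"
  shows "\<exists>c. p = (\<Sum>k<n. smult (c k) (orthonormal_poly \<mu> k))"
  using assms
proof (induction n arbitrary: p)
  case (Suc n)
  define b where "b = coeff p n"
  have "p - smult b (monom 1 n) = 0 \<or> degree (p - smult b (monom 1 n)) < n"
  proof (cases "n = 0")
    case True
    then show ?thesis
      using Suc.prems by (auto simp: b_def monom_0 degree_eq_zeroE elim!: degree_eq_zeroE)
  next
    case False
    have "degree (p - smult b (monom 1 n)) \<le> n - 1"
    proof (rule degree_le, intro allI impI)
      fix i assume "n - 1 < i"
      then have "i = n \<or> degree p < i \<and> i \<noteq> n"
        using Suc.prems False by auto
      then show "coeff (p - smult b (monom 1 n)) i = 0"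
        by (auto simp: b_def coeff_eq_0)
    qed
    with False show ?thesis
      by linarith
  qed
  then obtain c where c: "p - smult b (monom 1 n) = (\<Sum>k<n. smult (c k) (orthonormal_poly \<mu> k))"
    using Suc.IH by blast
  define d where "d k = L2_inner \<mu> (monom 1 n) (orthonormal_poly \<mu> k)" for k
  define N where "N = L2_norm \<mu> (residual n)"
  have "smult (of_real N) (orthonormal_poly \<mu> n) = residual n"
    using L2_norm_residual_pos[of n] by (simp add: orthonormal_poly_eq[of n] N_def)
  then have mon: "monom 1 n = smult (of_real N) (orthonormal_poly \<mu> n)
      + (\<Sum>k<n. smult (d k) (orthonormal_poly \<mu> k))"
    by (simp add: residual_def d_def)
  have sd: "smult b (\<Sum>k<n. smult (d k) (orthonormal_poly \<mu> k))
      = (\<Sum>k<n. smult (b * d k) (orthonormal_poly \<mu> k))"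
    by (induction n) (auto simp: smult_add_right)
  have "p = (p - smult b (monom 1 n)) + smult b (monom 1 n)"
    by simp
  also have "\<dots> = (\<Sum>k<n. smult (c k + b * d k) (orthonormal_poly \<mu> k))
      + smult (b * of_real N) (orthonormal_poly \<mu> n)"
    unfolding c by (subst mon) (simp add: smult_add_right sd smult_add_left sum.distrib)
  also have "\<dots> = (\<Sum>k<Suc n. smult (if k = n then b * of_real N else c k + b * d k) (orthonormal_poly \<mu> k))"
    by simp
  finally show ?case
    by (intro exI)
qed simp

section \<open>The extremal property of the Christoffel sum\<close>

text \<open>The diagonal of the reproducing kernel for degree below \<open>n\<close>, that is, the
  reciprocal of the Christoffel function.\<close>

definition christoffel_sum :: "nat \<Rightarrow> complex \<Rightarrow> real" where
  "christoffel_sum n x = (\<Sum>k<n. (cmod (poly (orthonormal_poly \<mu> k) x))\<^sup>2)"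

text \<open>Cauchy-Schwarz on the coefficients, whose square sum is the integral by
  Parseval.\<close>

lemma norm_poly_le_christoffel_sum:
  assumes "degree p < n"
  shows "(cmod (poly p x))\<^sup>2 \<le> christoffel_sum n x * (LINT z|\<mu>. (cmod (poly p z))\<^sup>2)"
proof -
  obtain c where c: "p = (\<Sum>k<n. smult (c k) (orthonormal_poly \<mu> k))"
    using orthonormal_poly_span assms by blast
  have "cmod (poly p x) \<le> (\<Sum>k<n. cmod (c k) * cmod (poly (orthonormal_poly \<mu> k) x))"
    unfolding c poly_sum by (rule order_trans[OF norm_sum]) (simp add: norm_mult)
  then have "(cmod (poly p x))\<^sup>2 \<le> (\<Sum>k<n. cmod (c k) * cmod (poly (orthonormal_poly \<mu> k) x))\<^sup>2"
    by (intro power_mono) auto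
  also have "\<dots> \<le> (\<Sum>k<n. (cmod (c k))\<^sup>2) * (\<Sum>k<n. (cmod (poly (orthonormal_poly \<mu> k) x))\<^sup>2)"
    by (rule Cauchy_Schwarz_ineq_sum)
  also have "(\<Sum>k<n. (cmod (c k))\<^sup>2) = (LINT z|\<mu>. (cmod (poly p z))\<^sup>2)"
    unfolding c by (rule Parseval_orthonormal_poly[symmetric])
  finally show ?thesis
    by (simp add: christoffel_sum_def mult.commute)
qed

text \<open>The bound is tested on the reproducing kernel at \<open>x\<close>: its value at
  \<open>x\<close> and its squared norm both equal the sum \<open>K\<close>, so K^2 \<le> X
  K.\<close>

lemma christoffel_sum_le:
  assumes n: "n > 0" and X: "0 \<le> X"
    and bd: "\<And>p. degree p < n \<Longrightarrow> (cmod (poly p x))\<^sup>2 \<le> X * (LINT z|\<mu>. (cmod (poly p z))\<^sup>2)"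
  shows "christoffel_sum n x \<le> X"
proof -
  define K where "K = christoffel_sum n x"
  define p where "p = (\<Sum>k<n. smult (cnj (poly (orthonormal_poly \<mu> k) x)) (orthonormal_poly \<mu> k))"
  have "degree p \<le> n - 1"
    unfolding p_def
  proof (intro degree_sum_le order_trans[OF degree_smult_le])
    show "degree (orthonormal_poly \<mu> k) \<le> n - 1" if "k \<in> {..<n}" for k
      using degree_orthonormal_poly[of k] that by auto
  qed simp
  then have deg: "degree p < n"
    using n by linarith
  have "poly p x = complex_of_real K"
    unfolding p_def K_def christoffel_sum_def poly_sum poly_smult of_real_sum complex_norm_square
    by (simp add: mult.commute)
  moreover have "(LINT z|\<mu>. (cmod (poly p z))\<^sup>2) = K"
    unfolding p_def Parseval_orthonormal_poly by (simp add: K_def christoffel_sum_def)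
  moreover have "0 \<le> K"
    by (simp add: K_def christoffel_sum_def sum_nonneg)
  ultimately have "K * K \<le> X * K"
    using bd[OF deg] by (simp add: power2_eq_square)
  then show ?thesis
    using \<open>0 \<le> K\<close> X unfolding K_def[symmetric] by (cases "K = 0") auto
qed

end

section \<open>The limit at a Lebesgue point\<close>

text \<open>Additivity on sets extends through indicator functions, linear combinations and monotone
  limits.\<close>

lemma nn_integral_add_measure:
  assumes sets: "sets M = sets N" "sets M1 = sets N" "sets M2 = sets N"
    and add: "\<And>A. A \<in> sets N \<Longrightarrow> emeasure M A = emeasure M1 A + emeasure M2 A"
    and f: "f \<in> borel_measurable N"
  shows "(\<integral>\<^sup>+x. f x \<partial>M) = (\<integral>\<^sup>+x. f x \<partial>M1) + (\<integral>\<^sup>+x. f x \<partial>M2)"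
proof -
  have eq: "borel_measurable M = borel_measurable N" "borel_measurable M1 = borel_measurable N"
      "borel_measurable M2 = borel_measurable N"
    using sets by (auto intro!: measurable_cong_sets)
  have sp: "space M = space N" "space M1 = space N" "space M2 = space N"
    using sets by (auto intro!: sets_eq_imp_space_eq)
  show ?thesis
    using f
  proof (induction rule: borel_measurable_induct)
    case (cong f g)
    have eqs: "integral\<^sup>N M f = integral\<^sup>N M g" "integral\<^sup>N M1 f = integral\<^sup>N M1 g"
        "integral\<^sup>N M2 f = integral\<^sup>N M2 g"
      by (intro nn_integral_cong; simp only: sp cong)+
    show ?case
      unfolding eqs by (rule cong)
  next
    case (set A)
    then show ?case
      using sets add by simp
  next
    case (mult u c)
    then have m: "u \<in> borel_measurable M" "u \<in> borel_measurable M1" "u \<in> borel_measurable M2"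
      by (auto simp only: eq)
    show ?case
      unfolding nn_integral_cmult[OF m(1)] nn_integral_cmult[OF m(2)] nn_integral_cmult[OF m(3)]
      by (simp add: mult.IH distrib_left)
  next
    case (add u v)
    then have m: "u \<in> borel_measurable M" "u \<in> borel_measurable M1" "u \<in> borel_measurable M2"
        "v \<in> borel_measurable M" "v \<in> borel_measurable M1" "v \<in> borel_measurable M2"
      by (auto simp only: eq)
    show ?case
      unfolding nn_integral_add[OF m(4,1)] nn_integral_add[OF m(5,2)] nn_integral_add[OF m(6,3)]
      by (simp add: add.IH add_ac)
  next
    case (seq U)
    have m: "U i \<in> borel_measurable M" "U i \<in> borel_measurable M1" "U i \<in> borel_measurable M2" for i
      using seq.hyps(1)[of i] by (simp_all only: eq)
    have SUP: "(\<integral>\<^sup>+x. (SUP i. U i) x \<partial>K) = (SUP i. \<integral>\<^sup>+x. U i x \<partial>K)"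
      if "\<And>i. U i \<in> borel_measurable K" for K
      unfolding SUP_apply by (rule nn_integral_monotone_convergence_SUP) (simp_all only: that \<open>incseq U\<close>)
    have inc: "incseq (\<lambda>i. \<integral>\<^sup>+x. U i x \<partial>K)" for K
      using \<open>incseq U\<close> by (auto intro!: nn_integral_mono simp: incseq_def le_fun_def)
    show ?case
      unfolding SUP[OF m(1)] SUP[OF m(2)] SUP[OF m(3)] seq.IH
      by (rule ennreal_SUP_add[OF inc inc])
  qed
qed

text \<open>Fejer averages at \<open>x\<close> depend only on the class of \<open>g\<close> and
  converge to the value of each representative.\<close>

lemma lebesgue_representative_value_unique:
  assumes x: "norm x = 1" and h1: "lebesgue_representative g x h1" and h2: "lebesgue_representative g x h2"
  shows "h1 x = h2 x"
proof -
  have "(\<lambda>n. LINT z|circle_measure. fejer n (cnj x * z) * h z) \<longlonglongrightarrow> h x"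
    if h: "lebesgue_representative g x h" for h
  proof (rule peak_kernel_Lebesgue_point[OF x _ _ peak_kernel_fejer[OF x] integral_fejer[OF x]])
    show "integrable circle_measure h"
      using h unfolding lebesgue_representative_def by blast
    show "((\<lambda>\<epsilon>. 1 / measure circle_measure (ball x \<epsilon>) *
            (LINT z:ball x \<epsilon>|circle_measure. \<bar>h z - h x\<bar>)) \<longlongrightarrow> 0) (at_right 0)"
      using h unfolding lebesgue_representative_def by blast
  qed
  from this[OF h1] this[OF h2] have "(\<lambda>n. LINT z|circle_measure. fejer n (cnj x * z) * h1 z) \<longlonglongrightarrow> h1 x"
      "(\<lambda>n. LINT z|circle_measure. fejer n (cnj x * z) * h2 z) \<longlonglongrightarrow> h2 x" .
  moreover have "(LINT z|circle_measure. fejer n (cnj x * z) * h1 z)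
      = (LINT z|circle_measure. fejer n (cnj x * z) * h2 z)" for n
  proof (rule integral_cong_AE)
    have "AE z in circle_measure. h1 z = g z" "AE z in circle_measure. h2 z = g z"
      using h1 h2 unfolding lebesgue_representative_def by blast+
    then show "AE z in circle_measure. fejer n (cnj x * z) * h1 z = fejer n (cnj x * z) * h2 z"
      by eventually_elim simp
    have [measurable]: "h1 \<in> borel_measurable circle_measure" "h2 \<in> borel_measurable circle_measure"
      using h1 h2 unfolding lebesgue_representative_def by blast+
    show "(\<lambda>z. fejer n (cnj x * z) * h1 z) \<in> borel_measurable circle_measure"
      "(\<lambda>z. fejer n (cnj x * z) * h2 z) \<in> borel_measurable circle_measure"
      by measurable
  qed
  ultimately show ?thesis
    by (simp only: LIMSEQ_unique)
qed

lemma lebesgue_value_eq: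
  assumes "norm x = 1" "lebesgue_representative g x h"
  shows "lebesgue_value g x = h x"
  unfolding lebesgue_value_def
  by (rule the_equality) (use assms lebesgue_representative_value_unique in blast)+

text \<open>Averages do not see null sets, so the limit found with \<open>h\<close> holds for
  integrals of \<open>g\<close> itself.\<close>

lemma peak_kernel_lebesgue_representative:
  assumes x: "norm x = 1" and h: "lebesgue_representative g x h" and g: "g \<in> borel_measurable borel"
    and k: "peak_kernel x k" and one: "\<And>n. n > 0 \<Longrightarrow> (LINT z|circle_measure. k n z) = 1"
  shows "(\<lambda>n. LINT z|circle_measure. k n z * g z) \<longlonglongrightarrow> h x"
proof -
  note g [measurable]
  have hi: "integrable circle_measure h" and hg: "AE z in circle_measure. h z = g z"
    and lim: "((\<lambda>\<epsilon>. 1 / measure circle_measure (ball x \<epsilon>) *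
            (LINT z:ball x \<epsilon>|circle_measure. \<bar>h z - h x\<bar>)) \<longlongrightarrow> 0) (at_right 0)"
    using h unfolding lebesgue_representative_def by blast+
  have [measurable]: "h \<in> borel_measurable circle_measure"
    using hi by (rule borel_measurable_integrable)
  have [measurable]: "k n \<in> borel_measurable borel" for n
    using k unfolding peak_kernel_def by blast
  have "(LINT z|circle_measure. k n z * g z) = (LINT z|circle_measure. k n z * h z)" for n
  proof (rule integral_cong_AE)
    show "AE z in circle_measure. k n z * g z = k n z * h z"
      using hg by eventually_elim simp
  qed measurable
  then show ?thesis
    using peak_kernel_Lebesgue_point[OF x hi lim k one] by simp
qed

text \<open>The two values come from unrelated representatives. If they were incompatible, every y >
  0 would have ln y far from \<open>l x\<close> or y far from \<open>h x\<close>, so the two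
  distances would add up to at least a fixed c > 0; yet their averages over small arcs both tend to
  0.\<close>

lemma lebesgue_value_exp:
  assumes x: "norm x = 1" and pos: "AE z in circle_measure. w z > 0"
    and h: "lebesgue_representative w x h" and l: "lebesgue_representative (\<lambda>z. ln (w z)) x l"
  shows "h x = exp (l x)"
proof (rule ccontr)
  assume neq: "h x \<noteq> exp (l x)"
  define d where "d = \<bar>h x - exp (l x)\<bar> / 2"
  have d: "d > 0"
    using neq by (simp add: d_def)
  have "isCont exp (l x)"
    by (rule isCont_exp)
  then obtain \<eta> where \<eta>: "\<eta> > 0" "\<And>y. \<bar>y - l x\<bar> < \<eta> \<Longrightarrow> \<bar>exp y - exp (l x)\<bar> < d"
    using d unfolding continuous_at_eps_delta dist_real_def by meson
  define c where "c = min \<eta> d"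
  have c: "c > 0"
    using d \<eta> by (simp add: c_def)
  have key: "c \<le> \<bar>y - h x\<bar> + \<bar>ln y - l x\<bar>" if y: "y > 0" for y
  proof (cases "\<bar>ln y - l x\<bar> < \<eta>")
    case True
    from \<eta>(2)[OF True] y have "\<bar>y - exp (l x)\<bar> < d"
      by simp
    then have "d \<le> \<bar>y - h x\<bar>"
      using abs_triangle_ineq4[of "y - exp (l x)" "y - h x"] unfolding d_def by simp
    then show ?thesis
      by (simp add: c_def)
  qed (simp add: c_def)
  have hi: "integrable circle_measure h" and hg: "AE z in circle_measure. h z = w z"
    and limh: "((\<lambda>\<epsilon>. 1 / measure circle_measure (ball x \<epsilon>) *
            (LINT z:ball x \<epsilon>|circle_measure. \<bar>h z - h x\<bar>)) \<longlongrightarrow> 0) (at_right 0)"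
    using h unfolding lebesgue_representative_def by blast+
  have li: "integrable circle_measure l" and lg: "AE z in circle_measure. l z = ln (w z)"
    and liml: "((\<lambda>\<epsilon>. 1 / measure circle_measure (ball x \<epsilon>) *
            (LINT z:ball x \<epsilon>|circle_measure. \<bar>l z - l x\<bar>)) \<longlongrightarrow> 0) (at_right 0)"
    using l unfolding lebesgue_representative_def by blast+
  have avg: "c \<le> 1 / measure circle_measure (ball x e) * (LINT z:ball x e|circle_measure. \<bar>h z - h x\<bar>)
      + 1 / measure circle_measure (ball x e) * (LINT z:ball x e|circle_measure. \<bar>l z - l x\<bar>)"
    if e: "e > 0" for e
  proof -
    define m where "m = measure circle_measure (ball x e)"
    have m: "m > 0"
      unfolding m_def by (rule measure_circle_ball_pos[OF x e])
    have i1: "integrable circle_measure (\<lambda>z. indicator (ball x e) z *\<^sub>R \<bar>h z - h x\<bar>)"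
      by (intro integrable_mult_indicator integrable_abs Bochner_Integration.integrable_diff hi) auto
    have i2: "integrable circle_measure (\<lambda>z. indicator (ball x e) z *\<^sub>R \<bar>l z - l x\<bar>)"
      by (intro integrable_mult_indicator integrable_abs Bochner_Integration.integrable_diff li) auto
    have "c * m = (LINT z|circle_measure. c * indicator (ball x e) z)"
      by (simp add: m_def)
    also have "\<dots> \<le> (LINT z|circle_measure. indicator (ball x e) z *\<^sub>R \<bar>h z - h x\<bar>
        + indicator (ball x e) z *\<^sub>R \<bar>l z - l x\<bar>)"
    proof (rule integral_mono_AE)
      show "integrable circle_measure (\<lambda>z. c * indicator (ball x e) z)"
        by (auto simp: circle.emeasure_eq_measure)
      show "integrable circle_measure (\<lambda>z. indicator (ball x e) z *\<^sub>R \<bar>h z - h x\<bar>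
        + indicator (ball x e) z *\<^sub>R \<bar>l z - l x\<bar>)"
        by (intro Bochner_Integration.integrable_add i1 i2)
      show "AE z in circle_measure. c * indicator (ball x e) z \<le> indicator (ball x e) z *\<^sub>R \<bar>h z - h x\<bar>
        + indicator (ball x e) z *\<^sub>R \<bar>l z - l x\<bar>"
        using hg lg pos
      proof eventually_elim
        case (elim z)
        then show ?case
          using key[of "w z"] by (simp add: indicator_def)
      qed
    qed
    also have "\<dots> = (LINT z:ball x e|circle_measure. \<bar>h z - h x\<bar>) + (LINT z:ball x e|circle_measure. \<bar>l z - l x\<bar>)"
      unfolding set_lebesgue_integral_def by (rule Bochner_Integration.integral_add[OF i1 i2])
    finally show ?thesis
      unfolding m_def[symmetric] using m by (simp add: field_simps)
  qed
  have "((\<lambda>e. 1 / measure circle_measure (ball x e) * (LINT z:ball x e|circle_measure. \<bar>h z - h x\<bar>)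
      + 1 / measure circle_measure (ball x e) * (LINT z:ball x e|circle_measure. \<bar>l z - l x\<bar>)) \<longlongrightarrow> 0 + 0) (at_right 0)"
    by (rule tendsto_add[OF limh liml])
  then have "c \<le> 0 + 0"
  proof (rule tendsto_lowerbound)
    show "eventually (\<lambda>e. c \<le> 1 / measure circle_measure (ball x e) * (LINT z:ball x e|circle_measure. \<bar>h z - h x\<bar>)
      + 1 / measure circle_measure (ball x e) * (LINT z:ball x e|circle_measure. \<bar>l z - l x\<bar>)) (at_right 0)"
      using eventually_at_right_less[of 0] by eventually_elim (rule avg)
  qed simp
  with c show False
    by simp
qed

text \<open>With zero integral the Christoffel bound makes \<open>p\<close> vanish on the whole open
  disc, an infinite set. This supplies the positivity for Gram-Schmidt.\<close>

lemma poly_eq_0_of_integral_eq_0: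
  fixes w :: "complex \<Rightarrow> real" and p :: "complex poly"
  assumes w: "integrable circle_measure w" "AE z in circle_measure. w z > 0"
    and lnw: "integrable circle_measure (\<lambda>z. ln (w z))"
    and p: "(LINT z|circle_measure. (norm (poly p z))\<^sup>2 * w z) = 0"
  shows "p = 0"
proof (rule ccontr)
  assume "p \<noteq> 0"
  have "poly p a = 0" if "norm a < 1" for a
    using christoffel_bound[OF w lnw lessI that, of p] p by (simp add: mult_le_0_iff)
  then have "ball 0 1 \<subseteq> {a. poly p a = 0}"
    by auto
  then have "finite (ball (0 :: complex) 1)"
    using poly_roots_finite[OF \<open>p \<noteq> 0\<close>] finite_subset by blast
  then show False
    using uncountable_ball[of 1 "0 :: complex"] countable_finite by auto
qed

theorem theorem1:
  fixes \<mu> \<mu>\<^sub>s :: "complex measure" and w :: "complex \<Rightarrow> real" and \<xi>\<^sub>0 :: complex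
  assumes "sets \<mu> = sets borel" and "prob_space \<mu>"
    and "emeasure \<mu> (- sphere 0 1) = 0"
    and "sets \<mu>\<^sub>s = sets borel" and "mutually_singular circle_measure \<mu>\<^sub>s"
    and "\<And>A. A \<in> sets borel \<Longrightarrow>
           emeasure \<mu> A = emeasure (density circle_measure (\<lambda>z. ennreal (w z))) A + emeasure \<mu>\<^sub>s A"
    and "integrable circle_measure w"
    and "AE z in circle_measure. w z > 0"
    and "integrable circle_measure (\<lambda>z. ln (w z))"
    and "\<xi>\<^sub>0 \<in> sphere 0 1"
    and "lebesgue_point w \<xi>\<^sub>0" and "lebesgue_point (\<lambda>z. ln (w z)) \<xi>\<^sub>0"
    and "((\<lambda>\<epsilon>. measure \<mu>\<^sub>s (ball \<xi>\<^sub>0 \<epsilon>) / measure circle_measure (ball \<xi>\<^sub>0 \<epsilon>)) \<longlongrightarrow> 0) (at_right 0)"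
  shows "(\<lambda>n. 1 / real n * (\<Sum>k<n. (cmod (poly (orthonormal_poly \<mu> k) \<xi>\<^sub>0))\<^sup>2))
           \<longlonglongrightarrow> inverse (lebesgue_value w \<xi>\<^sub>0)"
proof -
  note sets_mu = assms(1) and prob_mu = assms(2) and circle_mu = assms(3) and sets_mus = assms(4)
    and decomp = assms(6) and w = assms(7,8) and lnw = assms(9) and lim_mus = assms(13)
  interpret \<mu>: prob_space \<mu> by fact
  have x: "norm \<xi>\<^sub>0 = 1"
    using assms(10) by simp
  have wm [measurable]: "w \<in> borel_measurable borel"
    using borel_measurable_integrable[OF w(1)] by simp
  obtain h where h: "lebesgue_representative w \<xi>\<^sub>0 h"
    using assms(11) unfolding lebesgue_point_def by blast
  obtain l where l: "lebesgue_representative (\<lambda>z. ln (w z)) \<xi>\<^sub>0 l"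
    using assms(12) unfolding lebesgue_point_def by blast
  define v where "v = h \<xi>\<^sub>0"
  have vl: "v = exp (l \<xi>\<^sub>0)"
    unfolding v_def by (rule lebesgue_value_exp[OF x w(2) h l])
  then have v: "v > 0"
    by simp
  have lv: "lebesgue_value w \<xi>\<^sub>0 = v"
    unfolding v_def by (rule lebesgue_value_eq[OF x h])
  have AE_mu: "AE z in \<mu>. norm z = 1"
    by (rule AE_I[OF _ circle_mu]) (auto simp: sets_mu)
  have mus_le: "emeasure \<mu>\<^sub>s A \<le> emeasure \<mu> A" if "A \<in> sets borel" for A
    unfolding decomp[OF that] by simp
  have fin_mus: "finite_measure \<mu>\<^sub>s"
  proof (rule finite_measureI)
    have "space \<mu>\<^sub>s = space \<mu>"
      using sets_mus sets_mu by (intro sets_eq_imp_space_eq) simp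
    then have "emeasure \<mu>\<^sub>s (space \<mu>\<^sub>s) \<le> emeasure \<mu> (space \<mu>)"
      using mus_le[of UNIV] sets_eq_imp_space_eq[OF sets_mu] by simp
    also have "\<dots> < \<infinity>"
      by (simp add: \<mu>.emeasure_space_1)
    finally show "emeasure \<mu>\<^sub>s (space \<mu>\<^sub>s) \<noteq> \<infinity>"
      by simp
  qed
  have AE_mus: "AE z in \<mu>\<^sub>s. norm z = 1"
  proof (rule AE_I)
    show "emeasure \<mu>\<^sub>s (- sphere 0 1) = 0"
      using mus_le[of "- sphere 0 1"] circle_mu by simp
  qed (auto simp: sets_mus)
  \<comment> \<open>The decomposition speaks of sets, so it is transferred to integrals of
    nonnegative functions in \<open>ennreal\<close> and brought back by finiteness.\<close>
  have split: "(LINT z|\<mu>. f z) = (LINT z|circle_measure. f z * w z) + (LINT z|\<mu>\<^sub>s. f z)"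
    if f: "f \<in> borel_measurable borel" "continuous_on (sphere 0 1) f" "\<And>z. 0 \<le> f z"
    for f :: "complex \<Rightarrow> real"
  proof -
    note f(1)[measurable]
    have "integrable \<mu> f"
      by (rule integrable_on_circle[OF \<mu>.finite_measure_axioms sets_mu AE_mu f(1,2)])
    then have e1: "(\<integral>\<^sup>+z. ennreal (f z) \<partial>\<mu>) = ennreal (LINT z|\<mu>. f z)"
      by (rule nn_integral_eq_integral) (simp add: f)
    have "integrable \<mu>\<^sub>s f"
      by (rule integrable_on_circle[OF fin_mus sets_mus AE_mus f(1,2)])
    then have e2: "(\<integral>\<^sup>+z. ennreal (f z) \<partial>\<mu>\<^sub>s) = ennreal (LINT z|\<mu>\<^sub>s. f z)"
      by (rule nn_integral_eq_integral) (simp add: f)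
    have nn: "AE z in circle_measure. 0 \<le> f z * w z"
      using w(2) by eventually_elim (simp add: f)
    have "(\<integral>\<^sup>+z. ennreal (f z) \<partial>density circle_measure (\<lambda>z. ennreal (w z)))
        = (\<integral>\<^sup>+z. ennreal (w z) * ennreal (f z) \<partial>circle_measure)"
      by (subst nn_integral_density) auto
    also have "\<dots> = (\<integral>\<^sup>+z. ennreal (f z * w z) \<partial>circle_measure)"
      by (intro nn_integral_cong) (simp add: ennreal_mult' f mult.commute)
    also have "\<dots> = ennreal (LINT z|circle_measure. f z * w z)"
      by (rule nn_integral_eq_integral[OF integrable_mult_circle_measure[OF f(1,2) w(1)] nn])
    finally have e3: "(\<integral>\<^sup>+z. ennreal (f z) \<partial>density circle_measure (\<lambda>z. ennreal (w z)))
        = ennreal (LINT z|circle_measure. f z * w z)" .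
    have "(\<integral>\<^sup>+z. ennreal (f z) \<partial>\<mu>) = (\<integral>\<^sup>+z. ennreal (f z) \<partial>density circle_measure (\<lambda>z. ennreal (w z)))
        + (\<integral>\<^sup>+z. ennreal (f z) \<partial>\<mu>\<^sub>s)"
      by (rule nn_integral_add_measure[where N = borel]) (use sets_mu sets_mus decomp in auto)
    moreover have nonneg: "0 \<le> (LINT z|circle_measure. f z * w z)" "0 \<le> (LINT z|\<mu>\<^sub>s. f z)"
        "0 \<le> (LINT z|\<mu>. f z)"
      using integral_nonneg_AE[OF nn] f(3) by simp_all
    ultimately have "ennreal (LINT z|\<mu>. f z) = ennreal ((LINT z|circle_measure. f z * w z) + (LINT z|\<mu>\<^sub>s. f z))"
      unfolding e1 e2 e3 by (simp only: ennreal_plus)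
    then show ?thesis
      using nonneg by (subst (asm) ennreal_inj) auto
  qed
  have polysq: "(\<lambda>z. (cmod (poly p z))\<^sup>2) \<in> borel_measurable borel"
      "continuous_on (sphere 0 1) (\<lambda>z. (cmod (poly p z))\<^sup>2)" for p
    by (intro borel_measurable_continuous_onI continuous_intros)+
  \<comment> \<open>Discarding the singular part decreases the integral, the right direction for
    bounding |p|^2 relative to it from above.\<close>
  have ac_le: "(LINT z|circle_measure. (cmod (poly p z))\<^sup>2 * w z) \<le> (LINT z|\<mu>. (cmod (poly p z))\<^sup>2)" for p
    unfolding split[OF polysq[of p] zero_le_power2] by simp
  interpret circle_moment_measure \<mu>
  proof (rule circle_moment_measure.intro)
    show "finite_measure \<mu>" "sets \<mu> = sets borel" "AE z in \<mu>. norm z = 1"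
      using \<mu>.finite_measure_axioms sets_mu AE_mu .
    fix p :: "complex poly" assume p: "p \<noteq> 0"
    have "0 \<le> (LINT z|circle_measure. (cmod (poly p z))\<^sup>2 * w z)"
      by (rule integral_nonneg_AE) (use w(2) in eventually_elim, simp)
    moreover have "(LINT z|circle_measure. (cmod (poly p z))\<^sup>2 * w z) \<noteq> 0"
      using poly_eq_0_of_integral_eq_0[OF w lnw] p by blast
    ultimately show "0 < (LINT z|\<mu>. (cmod (poly p z))\<^sup>2)"
      using ac_le[of p] by linarith
  qed
  define y where "y n = christoffel_sum n \<xi>\<^sub>0 / real n" for n
  define \<Phi> where "\<Phi> n = (LINT z|\<mu>. fejer n (cnj \<xi>\<^sub>0 * z))" for n
  have lower: "1 \<le> y n * \<Phi> n" if n: "n > 0" for n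
  proof -
    \<comment> \<open>The value \<open>n\<close> at \<open>\<xi>\<^sub>0\<close> and a squared
      modulus of \<open>n\<close> times the Fejer kernel give n^2 \<le> (n y) (n \<Phi>) at index
      \<open>n\<close>.\<close>
    define p where "p = (\<Sum>j<n. monom (cnj \<xi>\<^sub>0 ^ j) j)"
    have pz: "poly p z = (\<Sum>j<n. (cnj \<xi>\<^sub>0 * z) ^ j)" for z
      by (simp add: p_def poly_sum poly_monom power_mult_distrib)
    have "degree p \<le> n - 1"
      unfolding p_def by (intro degree_sum_le order_trans[OF degree_monom_le]) auto
    then have deg: "degree p < n"
      using n by linarith
    have px: "poly p \<xi>\<^sub>0 = of_nat n"
      unfolding pz cnj_mult_self_of_norm_1[OF x] by simp
    have "(LINT z|\<mu>. (cmod (poly p z))\<^sup>2) = (LINT z|\<mu>. real n * fejer n (cnj \<xi>\<^sub>0 * z))"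
      using n by (simp add: pz fejer_def)
    also have "\<dots> = real n * \<Phi> n"
      by (simp add: \<Phi>_def)
    finally have "(real n)\<^sup>2 \<le> christoffel_sum n \<xi>\<^sub>0 * (real n * \<Phi> n)"
      using norm_poly_le_christoffel_sum[OF deg, of \<xi>\<^sub>0] by (simp add: px)
    also have "\<dots> = (real n)\<^sup>2 * (y n * \<Phi> n)"
      using n by (simp add: y_def power2_eq_square)
    finally show ?thesis
      using n by simp
  qed
  have \<Phi>: "\<Phi> \<longlonglongrightarrow> v"
  proof -
    have "(\<lambda>n. LINT z|circle_measure. fejer n (cnj \<xi>\<^sub>0 * z) * w z) \<longlonglongrightarrow> v"
      unfolding v_def
      by (rule peak_kernel_lebesgue_representative[OF x h wm peak_kernel_fejer[OF x] integral_fejer[OF x]])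
    moreover have "(\<lambda>n. LINT z|\<mu>\<^sub>s. fejer n (cnj \<xi>\<^sub>0 * z)) \<longlonglongrightarrow> 0"
      by (rule peak_kernel_integral_tendsto_0[OF fin_mus sets_mus AE_mus
            ratio_small_imp_measure_small[OF x lim_mus] peak_kernel_fejer[OF x]])
    ultimately have "(\<lambda>n. (LINT z|circle_measure. fejer n (cnj \<xi>\<^sub>0 * z) * w z)
        + (LINT z|\<mu>\<^sub>s. fejer n (cnj \<xi>\<^sub>0 * z))) \<longlonglongrightarrow> v + 0"
      by (rule tendsto_add)
    moreover have "\<Phi> = (\<lambda>n. (LINT z|circle_measure. fejer n (cnj \<xi>\<^sub>0 * z) * w z)
        + (LINT z|\<mu>\<^sub>s. fejer n (cnj \<xi>\<^sub>0 * z)))"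
      unfolding \<Phi>_def[abs_def] by (intro ext split) (auto intro!: continuous_intros fejer_nonneg)
    ultimately show ?thesis
      by simp
  qed
  have upper: "eventually (\<lambda>n. y n < b) sequentially" if b: "1 / v < b" for b
  proof -
    have vb: "1 < v * b"
      using b v by (simp add: field_simps)
    \<comment> \<open>\<open>1 - \<delta>\<close> is the midpoint between 1/(v b) and 1, so 1/(v (1
      - \<delta>)) is still below \<open>b\<close>.\<close>
    define \<delta> where "\<delta> = (1 - 1 / (v * b)) / 2"
    have \<delta>: "0 < \<delta>" "\<delta> < 1" "1 / (v * b) < 1 - \<delta>"
    proof -
      have "0 < 1 / (v * b)" "1 / (v * b) < 1"
        using vb by auto
      moreover have "2 * \<delta> = 1 - 1 / (v * b)"
        by (simp add: \<delta>_def)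
      ultimately show "0 < \<delta>" "\<delta> < 1" "1 / (v * b) < 1 - \<delta>"
        by linarith+
    qed
    define a where "a n = of_real (1 - \<delta> / real n) * \<xi>\<^sub>0" for n
    define A where "A n = (LINT z|circle_measure. poisson (a n) z * w z)" for n
    define G where "G n = (LINT z|circle_measure. poisson (a n) z * ln (w z))" for n
    define U where "U n = (1 + 4 * sqrt ((A n / exp (G n) - 1) / \<delta>))\<^sup>2 / (exp (G n) * (1 - \<delta>))" for n
    have na: "norm (a n) = 1 - \<delta> / real n" and a1: "norm (a n) < 1" if "n > 0" for n
    proof -
      have "0 \<le> 1 - \<delta> / real n"
        using that \<delta> by (simp add: field_simps)
      then show "norm (a n) = 1 - \<delta> / real n"
        unfolding a_def norm_mult norm_of_real x by simp
      then show "norm (a n) < 1"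
        using that \<delta> by simp
    qed
    have peak: "peak_kernel \<xi>\<^sub>0 (\<lambda>n. poisson (a n))"
      unfolding a_def using \<delta> by (intro peak_kernel_poisson[OF x]) auto
    have lnm: "(\<lambda>z. ln (w z)) \<in> borel_measurable borel"
      by measurable
    have A: "A \<longlonglongrightarrow> v"
      unfolding A_def v_def
      by (rule peak_kernel_lebesgue_representative[OF x h wm peak integral_poisson[OF a1]])
    have G: "G \<longlonglongrightarrow> l \<xi>\<^sub>0"
      unfolding G_def
      by (rule peak_kernel_lebesgue_representative[OF x l lnm peak integral_poisson[OF a1]])
    have "U \<longlonglongrightarrow> (1 + 4 * sqrt ((v / exp (l \<xi>\<^sub>0) - 1) / \<delta>))\<^sup>2 / (exp (l \<xi>\<^sub>0) * (1 - \<delta>))"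
      unfolding U_def using \<delta> by (intro tendsto_intros A G) auto
    \<comment> \<open>The equality of \<open>v\<close> and \<open>exp (l \<xi>\<^sub>0)\<close>
      makes the radicand vanish in the limit.\<close>
    then have "U \<longlonglongrightarrow> 1 / (v * (1 - \<delta>))"
      unfolding vl[symmetric] using v by simp
    moreover have "1 / (v * (1 - \<delta>)) < b"
    proof -
      have "1 < (1 - \<delta>) * (v * b)"
        using \<delta>(3) vb by (subst (asm) pos_divide_less_eq) auto
      then show ?thesis
        using \<delta> v by (subst pos_divide_less_eq) (auto simp: mult_ac)
    qed
    ultimately have Ub: "eventually (\<lambda>n. U n < b) sequentially"
      by (rule order_tendstoD(2))
    have yU: "y n \<le> U n" if n: "n > 0" for n
    proof -
      define r where "r = 1 - \<delta> / real n"
      have r: "0 \<le> r" "r < 1" "1 - r = \<delta> / real n"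
        using n \<delta> by (auto simp: r_def field_simps)
      have nr: "norm (a n) = r"
        using na[OF n] by (simp add: r_def)
      \<comment> \<open>As 1 - |a n|^2 is at least \<delta>/n, both terms of the Christoffel bound
        are at most multiples of sqrt n.\<close>
      define C where "C = sqrt (real n) * (1 + 4 * sqrt ((A n / exp (G n) - 1) / \<delta>))"
      have AG: "0 \<le> A n / exp (G n) - 1"
      proof -
        have "exp (G n) \<le> A n"
          unfolding A_def G_def
          by (rule exp_integral_ln_le[OF borel_measurable_poisson continuous_on_poisson[OF a1[OF n]]
                poisson_nonneg[OF a1[OF n]] integral_poisson[OF a1[OF n]] w lnw])
        then show ?thesis
          by simp
      qed
      have Cge: "sqrt (\<Sum>j<n. norm (a n) ^ (2 * j)) + 4 * sqrt ((A n / exp (G n) - 1) / (1 - (norm (a n))\<^sup>2)) \<le> C"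
      proof -
        have "(\<Sum>j<n. norm (a n) ^ (2 * j)) \<le> (\<Sum>j<n. 1)"
          using r nr by (intro sum_mono) (simp add: power_le_one)
        then have 1: "sqrt (\<Sum>j<n. norm (a n) ^ (2 * j)) \<le> sqrt (real n)"
          by simp
        have "r * r \<le> r * 1"
          using r by (intro mult_left_mono) auto
        then have ge: "\<delta> / real n \<le> 1 - (norm (a n))\<^sup>2"
          using r nr by (simp add: power2_eq_square)
        have dn: "0 < \<delta> / real n"
          using n \<delta> by simp
        have "(A n / exp (G n) - 1) / (1 - (norm (a n))\<^sup>2) \<le> (A n / exp (G n) - 1) / (\<delta> / real n)"
          using ge dn AG by (intro divide_left_mono mult_pos_pos less_le_trans[OF dn ge])
        then have "sqrt ((A n / exp (G n) - 1) / (1 - (norm (a n))\<^sup>2)) \<le> sqrt (real n * ((A n / exp (G n) - 1) / \<delta>))"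
          by (intro real_sqrt_le_mono) (simp add: mult.commute)
        then have 2: "sqrt ((A n / exp (G n) - 1) / (1 - (norm (a n))\<^sup>2)) \<le> sqrt (real n) * sqrt ((A n / exp (G n) - 1) / \<delta>)"
          unfolding real_sqrt_mult .
        have "C = sqrt (real n) + 4 * (sqrt (real n) * sqrt ((A n / exp (G n) - 1) / \<delta>))"
          by (simp add: C_def distrib_left)
        with 1 2 show ?thesis
          by linarith
      qed
      have C0: "0 \<le> C"
        unfolding C_def using AG \<delta> by (intro mult_nonneg_nonneg add_nonneg_nonneg) auto
      \<comment> \<open>(1 + r)/2 is 1 - \<delta>/(2 n), so Bernoulli's inequality with exponent 2 n
        loses exactly \<delta>, whatever \<open>n\<close> is.\<close>
      have bern: "1 - \<delta> \<le> (((1 + r) / 2) ^ n)\<^sup>2"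
      proof -
        have "1 + real (n * 2) * (- (\<delta> / (2 * real n))) \<le> (1 + - (\<delta> / (2 * real n))) ^ (n * 2)"
          using n \<delta> by (intro Bernoulli_inequality) (simp add: field_simps)
        moreover have eq: "1 + - (\<delta> / (2 * real n)) = (1 + r) / 2"
          by (simp add: r_def field_simps)
        ultimately have "1 + real (n * 2) * (- (\<delta> / (2 * real n))) \<le> ((1 + r) / 2) ^ (n * 2)"
          by (simp only: eq)
        then show ?thesis
          using n by (simp add: power_mult)
      qed
      have "christoffel_sum n \<xi>\<^sub>0 \<le> C\<^sup>2 / (exp (G n) * (1 - \<delta>))"
      proof (rule christoffel_sum_le[OF n])
        show "0 \<le> C\<^sup>2 / (exp (G n) * (1 - \<delta>))"
          using \<delta> by simp
        fix p :: "complex poly" assume p: "degree p < n"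
        define I where "I = (LINT z|\<mu>. (cmod (poly p z))\<^sup>2)"
        obtain q where q: "degree q \<le> degree p" "\<And>z. norm z = 1 \<Longrightarrow> norm (poly q z) = norm (poly p z)"
          "((1 + r) / 2) ^ degree p * norm (poly p \<xi>\<^sub>0) \<le> norm (poly q (of_real r * \<xi>\<^sub>0))"
          using reflect_zeros[of p] x r by (metis less_imp_le)
        have Iq: "(LINT z|\<mu>. (cmod (poly q z))\<^sup>2) = I"
          unfolding I_def
        proof (rule integral_cong_AE)
          show "AE z in \<mu>. (cmod (poly q z))\<^sup>2 = (cmod (poly p z))\<^sup>2"
            using AE_mu by eventually_elim (simp add: q(2))
        qed (use polysq(1) sets_mu in \<open>simp_all cong: measurable_cong_sets\<close>)
        have I0: "0 \<le> I"
          by (simp add: I_def)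
        \<comment> \<open>The exponent is raised from \<open>degree p\<close> to \<open>n\<close>,
          as the base is at most 1; the loss then does not depend on \<open>p\<close>.\<close>
        have "((1 + r) / 2) ^ n * norm (poly p \<xi>\<^sub>0) \<le> ((1 + r) / 2) ^ degree p * norm (poly p \<xi>\<^sub>0)"
          using r p by (intro mult_right_mono power_decreasing) auto
        also have "\<dots> \<le> norm (poly q (a n))"
          using q(3) by (simp add: a_def r_def)
        finally have "((1 + r) / 2) ^ n * norm (poly p \<xi>\<^sub>0) * exp (G n / 2) \<le> norm (poly q (a n)) * exp (G n / 2)"
          by (intro mult_right_mono) auto
        also have "\<dots> \<le> sqrt (LINT z|circle_measure. (norm (poly q z))\<^sup>2 * w z) *
           (sqrt (\<Sum>j<n. norm (a n) ^ (2 * j)) + 4 * sqrt ((A n / exp (G n) - 1) / (1 - (norm (a n))\<^sup>2)))"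
          unfolding A_def G_def
          by (rule christoffel_bound[OF w lnw _ a1[OF n]]) (use q(1) p in linarith)
        also have "\<dots> \<le> sqrt (LINT z|circle_measure. (norm (poly q z))\<^sup>2 * w z) * C"
        proof (rule mult_left_mono[OF Cge])
          have "0 \<le> (LINT z|circle_measure. (norm (poly q z))\<^sup>2 * w z)"
            by (rule integral_nonneg_AE) (use w(2) in eventually_elim, simp)
          then show "0 \<le> sqrt (LINT z|circle_measure. (norm (poly q z))\<^sup>2 * w z)"
            by simp
        qed
        also have "\<dots> \<le> sqrt I * C"
          using ac_le[of q] C0 unfolding Iq by (intro mult_right_mono real_sqrt_le_mono)
        finally have "(((1 + r) / 2) ^ n * norm (poly p \<xi>\<^sub>0) * exp (G n / 2))\<^sup>2 \<le> (sqrt I * C)\<^sup>2"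
          using r by (intro power_mono) auto
        then have "(((1 + r) / 2) ^ n)\<^sup>2 * ((norm (poly p \<xi>\<^sub>0))\<^sup>2 * exp (G n)) \<le> I * C\<^sup>2"
          using I0 by (simp add: power_mult_distrib exp_double[symmetric] mult_ac)
        moreover have "(1 - \<delta>) * ((norm (poly p \<xi>\<^sub>0))\<^sup>2 * exp (G n))
            \<le> (((1 + r) / 2) ^ n)\<^sup>2 * ((norm (poly p \<xi>\<^sub>0))\<^sup>2 * exp (G n))"
          using bern by (intro mult_right_mono) auto
        ultimately have "(1 - \<delta>) * ((norm (poly p \<xi>\<^sub>0))\<^sup>2 * exp (G n)) \<le> I * C\<^sup>2"
          by linarith
        then show "(cmod (poly p \<xi>\<^sub>0))\<^sup>2 \<le> C\<^sup>2 / (exp (G n) * (1 - \<delta>)) * (LINT z|\<mu>. (cmod (poly p z))\<^sup>2)"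
          unfolding I_def[symmetric] using \<delta> by (simp add: field_simps)
      qed
      then have "y n \<le> C\<^sup>2 / (exp (G n) * (1 - \<delta>)) / real n"
        unfolding y_def by (intro divide_right_mono) auto
      also have "\<dots> = U n"
        unfolding U_def C_def using n by (simp add: power_mult_distrib)
      finally show ?thesis .
    qed
    show ?thesis
      using Ub eventually_gt_at_top[of 0]
      by eventually_elim (use yU le_less_trans in blast)
  qed
  have "y \<longlonglongrightarrow> 1 / v"
  proof (rule order_tendstoI)
    fix b assume b: "b < 1 / v"
    \<comment> \<open>\<open>lower\<close> yields 1/\<Phi> n \<le> y n as soon as \<Phi> n > 0,
      which holds eventually because the limit \<open>v\<close> is positive.\<close>
    have "(\<lambda>n. 1 / \<Phi> n) \<longlonglongrightarrow> 1 / v"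
      by (intro tendsto_intros \<Phi>) (use v in simp)
    then have "eventually (\<lambda>n. b < 1 / \<Phi> n) sequentially"
      using b by (rule order_tendstoD(1))
    moreover have "eventually (\<lambda>n. 0 < \<Phi> n) sequentially"
      using \<Phi> v by (rule order_tendstoD(1))
    ultimately show "eventually (\<lambda>n. b < y n) sequentially"
      using eventually_gt_at_top[of 0]
    proof eventually_elim
      case (elim n)
      then have "1 / \<Phi> n \<le> y n"
        using lower[of n] by (simp add: field_simps)
      then show ?case
        using elim by linarith
    qed
  qed (rule upper)
  then show ?thesis
    unfolding lv by (simp add: y_def[abs_def] christoffel_sum_def inverse_eq_divide)
qed

end
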